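(* Let $i\ne j$, $m\ge1$, and $k<k'$ with $k,k'\in\{0,1,\dots,2^{n+m-1}\}$. Let $\alpha'\in(\alpha,1/2)$, $\varepsilon_0\in(0,1/2)$ and $0<\gamma\le 1/4$. If $n$ is such that $$\max_{r\le 2^n}\{|\Lambda_i(t_r^n)|,|\Lambda_j(t_r^n)|\}\le\Delta_n^{\alpha'}$$ and $$\Big|\sum_{r=l+1}^{q}\Lambda_i(t_r^n)\Lambda_j(t_r^n)\Big|\le\varepsilon_0(q-l)^\beta\Delta_n^{2\alpha'}\quad\text{for all }0\le l<q\le 2^n,$$ then $$P_n\left(|L_{i,j}^{n+m}(k')-L_{i,j}^{n+m}(k)|>(k'-k)^\beta\Delta_{n+m}^{2\alpha}\right)\le 8\exp\left(-\tfrac12\gamma(k'-k)^{\beta-1/2}\Delta_n^{2(\alpha-\alpha')}\Delta_m^{2\alpha-1}\right).$$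
   Context: Fix $\alpha\in(1/3,1/2)$, $\beta\in(1-\alpha,2\alpha)$. Let $\Delta_n=2^{-n}$, $t_k^n=k2^{-n}$. $Z=(Z_1,\dots,Z_{d'})$ is a standard $d'$-dimensional Brownian motion on $[0,1]$ given by the L\'evy--Ciesielski construction $Z_i(t)=W_{i,0}^0t+\sum_{n\ge1}\sum_{k=1}^{2^{n-1}}W_{i,k}^n\int_0^tH_k^n(s)ds$, where the $W_{i,k}^n$ are i.i.d. standard normal, $H(t)=I(0\le t<1/2)-I(1/2\le t\le1)$ and $H_k^n(t)=2^{(n-1)/2}H(2^{n-1}t-k+1)$. $\mathcal F_n$ is the $\sigma$-field generated by all $W_{i,k}^m$ with $m\le n$ (equivalently by $Z$ on $\{t_k^n:0\le k\le2^n\}$), and $P_n$ denotes conditional probability given $\mathcal F_n$; the two displayed hypotheses are $\mathcal F_n$-measurable and the conclusion holds (a.s.) on the event where they hold. $\Lambda_i(t_r^n)=\Lambda_i^n(t_r^n)=Z_i(t_r^n)-Z_i(t_{r-1}^n)$, $1\le r\le 2^n$. For $n\ge1$, $L_{i,j}^n(0)=0$ and $L_{i,j}^n(k)=\sum_{r=1}^k\Lambda_i^n(t_{2r-1}^n)\Lambda_j^n(t_{2r}^n)$ for $1\le k\le2^{n-1}$. *)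

theory Defs
  imports "HOL-Probability.Probability"
begin

definition mesh :: "nat \<Rightarrow> real"  (\<open>\<Delta>\<close>)
  where "\<Delta> n = 1 / 2 ^ n"

definition dyadic :: "nat \<Rightarrow> nat \<Rightarrow> real"
  where "dyadic n k = real k / 2 ^ n"

definition haar_mother :: "real \<Rightarrow> real"
  where "haar_mother t = indicat_real {0..<1/2} t - indicat_real {1/2..1} t"

text \<open>Used for \<open>n \<ge> 1\<close> and \<open>1 \<le> k \<le> 2 ^ (n - 1)\<close> only.\<close>

definition haar :: "nat \<Rightarrow> nat \<Rightarrow> real \<Rightarrow> real"
  where "haar n k t = 2 powr ((real n - 1) / 2) * haar_mother (2 ^ (n - 1) * t - real k + 1)"

text \<open>
  The triples \<open>(i, n, k)\<close> for which a coefficient \<open>W i n k\<close> (coordinate \<open>i\<close>, level \<open>n\<close>,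
  position \<open>k\<close>) occurs in the construction; level \<open>0\<close> has the single position \<open>0\<close>.
\<close>

definition coeff_index :: "nat \<Rightarrow> (nat \<times> nat \<times> nat) set"
  where "coeff_index d =
    {(i, n, k). i \<in> {1..d} \<and> (if n = 0 then k = 0 else k \<in> {1..2 ^ (n - 1)})}"

locale levy_ciesielski = prob_space M for M :: "'a measure" +
  fixes d :: nat
    and W :: "nat \<Rightarrow> nat \<Rightarrow> nat \<Rightarrow> 'a \<Rightarrow> real"
  assumes indep_coeffs: "indep_vars (\<lambda>_. borel) (\<lambda>(i, n, k). W i n k) (coeff_index d)"
    and normal_coeffs:
      "\<And>i n k. (i, n, k) \<in> coeff_index d \<Longrightarrow> distributed M lborel (W i n k) std_normal_density"

text \<open>
  The summation variable \<open>n\<close> is the level minus one. At a dyadic time \<open>t \<in> [0, 1]\<close> all but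
  finitely many levels contribute \<open>0\<close>, so there the series converges for every \<open>\<omega>\<close>, not just
  almost every one.
\<close>

definition bm :: "(nat \<Rightarrow> nat \<Rightarrow> nat \<Rightarrow> 'a \<Rightarrow> real) \<Rightarrow> nat \<Rightarrow> real \<Rightarrow> 'a \<Rightarrow> real"
  where "bm W i t \<omega> = W i 0 0 \<omega> * t +
    (\<Sum>n. \<Sum>k = 1..2 ^ n. W i (Suc n) k \<omega> * (LBINT s:{0..t}. haar (Suc n) k s))"

definition level_field ::
    "'a measure \<Rightarrow> nat \<Rightarrow> (nat \<Rightarrow> nat \<Rightarrow> nat \<Rightarrow> 'a \<Rightarrow> real) \<Rightarrow> nat \<Rightarrow> 'a measure"
  where "level_field M d W n = sigma (space M)
    {W i m k -` B \<inter> space M | i m k B. (i, m, k) \<in> coeff_index d \<and> m \<le> n \<and> B \<in> sets borel}"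

definition cond_prob_given :: "'a measure \<Rightarrow> 'a measure \<Rightarrow> 'a set \<Rightarrow> 'a \<Rightarrow> real"
  where "cond_prob_given M F A = real_cond_exp M F (indicat_real A)"

definition incr ::
    "(nat \<Rightarrow> nat \<Rightarrow> nat \<Rightarrow> 'a \<Rightarrow> real) \<Rightarrow> nat \<Rightarrow> nat \<Rightarrow> nat \<Rightarrow> 'a \<Rightarrow> real"
  where "incr W n i r \<omega> = bm W i (dyadic n r) \<omega> - bm W i (dyadic n (r - 1)) \<omega>"

definition area_sum ::
    "(nat \<Rightarrow> nat \<Rightarrow> nat \<Rightarrow> 'a \<Rightarrow> real) \<Rightarrow> nat \<Rightarrow> nat \<Rightarrow> nat \<Rightarrow> nat \<Rightarrow> 'a \<Rightarrow> real"
  where "area_sum W n i j k \<omega> = (\<Sum>r = 1..k. incr W n i (2 * r - 1) \<omega> * incr W n j (2 * r) \<omega>)"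

end

theory Submission
  imports Defs
begin

text \<open>
  The idea is that, once the level-\<open>n\<close> skeleton is known, the area increment is a quadratic
  polynomial in Gaussian variables, and its exponential moments can be computed explicitly.

  Inside a level-\<open>n\<close> interval the path is the linear interpolation of the skeleton plus a Brownian
  bridge which is built from the coefficients of the levels \<open>n + 1, ..., n + m\<close> only. Midpoint
  displacement (\<open>bm_midpoint\<close>) shows this: at a dyadic midpoint the new value is the average of the
  two neighbours plus \<open>sqrt (\<Delta> n) / 2\<close> times one new coefficient. Hence a level-\<open>(n + m)\<close> increment is
  \<open>2 ^ (- m)\<close> times the increment of its level-\<open>n\<close> block plus a centred term \<open>bridge\<close>
  (\<open>incr_eq_bridge\<close>), and the difference of the two area sums is
  \<open>\<Sum>r. (\<mu> r + x r) * (\<nu> r + y r)\<close>, where \<open>\<mu>\<close> and \<open>\<nu>\<close> are functions of the skeleton, while the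
  bridge vectors \<open>x\<close> and \<open>y\<close> are independent of it and of each other. The covariance of each bridge
  vector is at most \<open>\<sigma> = \<Delta> (n + m)\<close> times the identity, because each displacement step is, up to
  scaling, an orthogonal transformation (\<open>bridge_linear\<close>).

  For such a bilinear form the exponential moment is bounded by \<open>chaos_exp_bound\<close>: integrating out
  \<open>x\<close> leaves the exponential of a quadratic form in \<open>y\<close>, an auxiliary Gaussian vector makes this
  linear in \<open>y\<close>, and after integrating out \<open>y\<close> only one-dimensional Gaussian integrals remain. With
  \<open>\<kappa> = k' - k\<close> terms and threshold \<open>T = \<kappa> powr \<beta> * \<sigma> powr (2 * \<alpha>)\<close>, take
  \<open>t = \<Delta> n powr (1 - 2 * \<alpha>') / (2 * \<sigma> * sqrt \<kappa>)\<close>. The exponential moment at \<open>t\<close> and at \<open>- t\<close> is then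
  at most \<open>exp (1 / 2) * exp (t * \<bar>\<Sum>r. \<mu> r * \<nu> r\<bar>)\<close>, and \<open>t * T = X / 2\<close>, where the exponent in
  the claim is \<open>- \<gamma> * X / 2\<close>.

  The sum of the conditional means is at most \<open>3 / 4 * T\<close>: complete blocks are controlled by the
  hypothesis on sums of products, incomplete ones, which exist only if \<open>m \<ge> 2\<close>, by the hypothesis on
  single increments (\<open>abs_sum_div_le\<close>, \<open>mean_numeric_bound\<close>). Markov's inequality therefore gives the
  bound \<open>2 * exp (1 / 2) * exp (- X / 8)\<close> for each fixed skeleton (\<open>frozen_area_tail\<close>), and
  \<open>cond_prob_given_le_freezing\<close> turns this into a statement on the conditional probability.
\<close>

section \<open>Midpoint displacement\<close>

text \<open>
  The primitive of the Haar mother function. It vanishes outside the unit interval, so a rescaled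
  copy of it is the Schauder function of a Haar function.
\<close>

definition tent :: "real \<Rightarrow> real"
  where "tent x = max 0 (min x (1 - x))"

lemma tent_of_int [simp]: "tent (of_int z) = 0"
proof -
  have "z \<le> 0 \<or> z \<ge> 1" by linarith
  then have "real_of_int z \<le> 0 \<or> real_of_int z \<ge> 1" by auto
  then show ?thesis by (auto simp: tent_def)
qed

text \<open>
  The tent is affine between its break points, so only an interval with one of \<open>0\<close>, \<open>1/2\<close>, \<open>1\<close> in its
  interior can violate the midpoint identity.
\<close>

lemma tent_midpoint:
  assumes "x \<le> y" "y \<le> 0 \<or> 0 \<le> x" "y \<le> 1/2 \<or> 1/2 \<le> x" "y \<le> 1 \<or> 1 \<le> x"
  shows "tent ((x + y) / 2) = (tent x + tent y) / 2"
  using assms by (auto simp: tent_def max_def min_def field_simps split: if_splits)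

lemma lborel_integral_indicator_Int:
  fixes a b t :: real
  assumes "0 \<le> a" "a \<le> b"
  shows "(LBINT s. indicator {0..t} s * indicator {a..<b} s) = max 0 (min t b - a)"
    and "(LBINT s. indicator {0..t} s * indicator {a..b} s) = max 0 (min t b - a)"
    and "integrable lborel (\<lambda>s. indicator {0..t} s * indicator {a..<b} s :: real)"
    and "integrable lborel (\<lambda>s. indicator {0..t} s * indicator {a..b} s :: real)"
proof -
  consider "t < a" | "a \<le> t" "t < b" | "b \<le> t" by linarith
  then have "measure lborel ({0..t} \<inter> {a..<b}) = max 0 (min t b - a)
      \<and> measure lborel ({0..t} \<inter> {a..b}) = max 0 (min t b - a)"
  proof cases
    case 1
    then have "{0..t} \<inter> {a..<b} = {}" "{0..t} \<inter> {a..b} = {}" by auto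
    then show ?thesis using 1 assms by simp
  next
    case 2
    then have "{0..t} \<inter> {a..<b} = {a..t}" "{0..t} \<inter> {a..b} = {a..t}" using assms by auto
    then show ?thesis using 2 assms by simp
  next
    case 3
    then have "{0..t} \<inter> {a..<b} = {a..<b}" "{0..t} \<inter> {a..b} = {a..b}" using assms by auto
    then show ?thesis using 3 assms by simp
  qed
  moreover have int: "integrable lborel (indicat_real ({0..t} \<inter> A))" if "A \<in> sets borel" for A
  proof -
    have "emeasure lborel ({0..t} \<inter> A) \<le> emeasure lborel {0..t}"
      by (rule emeasure_mono) auto
    also have "\<dots> < \<infinity>" by (cases "0 \<le> t") auto
    finally show ?thesis using that by (intro integrable_real_indicator) auto
  qed
  ultimately show "(LBINT s. indicator {0..t} s * indicator {a..<b} s) = max 0 (min t b - a)"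
    "(LBINT s. indicator {0..t} s * indicator {a..b} s) = max 0 (min t b - a)"
    unfolding indicator_inter_arith[symmetric] by (simp_all del: Int_atLeastAtMost)
  show "integrable lborel (\<lambda>s. indicator {0..t} s * indicator {a..<b} s :: real)"
    "integrable lborel (\<lambda>s. indicator {0..t} s * indicator {a..b} s :: real)"
    unfolding indicator_inter_arith[symmetric] by (rule int, simp)+
qed

lemma haar_primitive:
  assumes "1 \<le> k"
  shows "(LBINT s:{0..t}. haar (Suc h) k s)
    = 2 powr (real h / 2) / 2 ^ h * tent (2 ^ h * t - real k + 1)"
proof -
  define a b c :: real where "a = (real k - 1) / 2 ^ h" and "b = (real k - 1/2) / 2 ^ h"
    and "c = real k / 2 ^ h"
  have ord: "0 \<le> a" "a \<le> b" "b \<le> c" using assms by (auto simp: a_def b_def c_def field_simps)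
  have haar_eq: "haar (Suc h) k s = 2 powr (real h / 2) * (indicator {a..<b} s - indicator {b..c} s)" for s
  proof -
    have "(2 ^ h * s - real k + 1 \<in> {0..<1/2}) = (s \<in> {a..<b})"
      "(2 ^ h * s - real k + 1 \<in> {1/2..1}) = (s \<in> {b..c})"
      by (auto simp: a_def b_def c_def field_simps)
    then show ?thesis
      by (simp add: haar_def haar_mother_def indicator_def)
  qed
  define y where "y = 2 ^ h * t - real k + 1"
  have t: "t = (y + real k - 1) / 2 ^ h" by (simp add: y_def field_simps)
  have "(LBINT s:{0..t}. haar (Suc h) k s) = (LBINT s. 2 powr (real h / 2) *
      (indicator {0..t} s * indicator {a..<b} s - indicator {0..t} s * indicator {b..c} s))"
    by (simp add: set_lebesgue_integral_def haar_eq algebra_simps)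
  also have "\<dots> = 2 powr (real h / 2) * (max 0 (min t b - a) - max 0 (min t c - b))"
    using ord by (simp add: lborel_integral_indicator_Int)
  also have "max 0 (min t b - a) - max 0 (min t c - b) = tent y / 2 ^ h"
  proof -
    have "min t b - a = min y (1/2) / 2 ^ h" "min t c - b = min (y - 1/2) (1/2) / 2 ^ h"
      by (auto simp: t a_def b_def c_def min_def field_simps)
    moreover have "max 0 (x / 2 ^ h) = max 0 x / 2 ^ h" for x :: real
      by (simp add: max_def field_simps)
    ultimately have "max 0 (min t b - a) - max 0 (min t c - b)
        = (max 0 (min y (1/2)) - max 0 (min (y - 1/2) (1/2))) / 2 ^ h"
      by (simp add: diff_divide_distrib)
    also have "max 0 (min y (1/2)) - max 0 (min (y - 1/2) (1/2)) = tent y"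
      by (auto simp: tent_def max_def min_def)
    finally show ?thesis .
  qed
  finally show ?thesis by (simp add: y_def)
qed

text \<open>
  At a multiple of \<open>2 ^ (- n)\<close> all Schauder functions of level above \<open>n\<close> are evaluated at an integer
  argument of the tent, hence vanish.
\<close>

lemma bm_dyadic:
  "bm W i (dyadic n r) \<omega> = W i 0 0 \<omega> * dyadic n r + (\<Sum>h<n. \<Sum>k = 1..2 ^ h.
    W i (Suc h) k \<omega> * (2 powr (real h / 2) / 2 ^ h * tent (2 ^ h * dyadic n r - real k + 1)))"
proof -
  have "tent (2 ^ h * dyadic n r - real k + 1) = 0" if "n \<le> h" for h k
  proof -
    have "2 ^ h * dyadic n r - real k + 1 = of_int (2 ^ (h - n) * int r - int k + 1)"
    proof -
      have "(2::real) ^ h = 2 ^ (h - n) * 2 ^ n" using that by (simp flip: power_add)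
      then show ?thesis by (simp add: dyadic_def)
    qed
    then show ?thesis by (simp only: tent_of_int)
  qed
  then have "(\<Sum>h. \<Sum>k = 1..2 ^ h. W i (Suc h) k \<omega> * (LBINT s:{0..dyadic n r}. haar (Suc h) k s))
    = (\<Sum>h<n. \<Sum>k = 1..2 ^ h. W i (Suc h) k \<omega> * (LBINT s:{0..dyadic n r}. haar (Suc h) k s))"
    by (intro suminf_finite) (auto simp: haar_primitive)
  then show ?thesis
    unfolding bm_def by (simp add: haar_primitive)
qed

lemma dyadic_Suc_double: "dyadic (Suc n) (2 * r) = dyadic n r"
  by (simp add: dyadic_def)

text \<open>
  Midpoint displacement. Schauder functions of level at most \<open>n\<close> are affine on a level-\<open>n\<close> interval,
  and exactly one of level \<open>n + 1\<close> is nonzero at its midpoint.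
\<close>

lemma bm_midpoint:
  assumes "r < 2 ^ n"
  shows "bm W i (dyadic (Suc n) (Suc (2 * r))) \<omega>
    = (bm W i (dyadic n r) \<omega> + bm W i (dyadic n (Suc r)) \<omega>) / 2 + sqrt (\<Delta> n) / 2 * W i (Suc n) (Suc r) \<omega>"
proof -
  let ?t = "dyadic (Suc n) (Suc (2 * r))" and ?x = "dyadic n r" and ?y = "dyadic n (Suc r)"
  define c where "c h = 2 powr (real h / 2) / 2 ^ h" for h :: nat
  have t: "?t = (?x + ?y) / 2" by (simp add: dyadic_def field_simps)
  \<comment> \<open>The break points of the tent pull back to multiples of \<open>2 ^ (- n)\<close>, as \<open>h < n\<close>.\<close>
  have coarse: "tent (2 ^ h * ?t - real k + 1)
      = (tent (2 ^ h * ?x - real k + 1) + tent (2 ^ h * ?y - real k + 1)) / 2" if "h < n" for h k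
  proof -
    have "2 ^ h * ?t - real k + 1 = ((2 ^ h * ?x - real k + 1) + (2 ^ h * ?y - real k + 1)) / 2"
      by (simp only: t) (simp add: algebra_simps add_divide_distrib diff_divide_distrib)
    moreover have "2 ^ h * ?y - real k + 1 \<le> real z / 2 \<or> real z / 2 \<le> 2 ^ h * ?x - real k + 1" for z
    proof -
      define q where "q = (2::int) ^ (n - h - 1)"
      have "(2::real) ^ n = 2 ^ h * (2 * of_int q)"
        using that by (simp add: q_def flip: power_add power_Suc)
      then have xy: "2 ^ h * ?x = real r / (2 * of_int q)" "2 ^ h * ?y = (real r + 1) / (2 * of_int q)"
        by (simp_all add: dyadic_def)
      have q: "real_of_int q > 0" by (simp add: q_def)
      have "int r + 1 \<le> q * (int z + 2 * int k - 2) \<or> q * (int z + 2 * int k - 2) \<le> int r" by linarith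
      then have "real_of_int (int r + 1) \<le> real_of_int (q * (int z + 2 * int k - 2))
          \<or> real_of_int (q * (int z + 2 * int k - 2)) \<le> real_of_int (int r)"
        by (simp only: of_int_le_iff)
      then show ?thesis
        unfolding xy using q by (auto simp: field_simps)
    qed
    from this[of 0] this[of 1] this[of 2]
    have "tent (((2 ^ h * ?x - real k + 1) + (2 ^ h * ?y - real k + 1)) / 2)
      = (tent (2 ^ h * ?x - real k + 1) + tent (2 ^ h * ?y - real k + 1)) / 2"
      by (intro tent_midpoint) (auto simp: dyadic_def divide_right_mono)
    ultimately show ?thesis by (simp only:)
  qed
  have fine: "tent (2 ^ n * ?t - real k + 1) = (if k = Suc r then 1/2 else 0)" for k
  proof -
    have "2 ^ n * ?t - real k + 1 = 1/2 + real_of_int (int r + 1 - int k)"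
      by (simp add: dyadic_def field_simps)
    moreover have "tent (1/2 + real_of_int z) = (if z = 0 then 1/2 else 0)" for z
    proof -
      have "z \<le> -1 \<or> z = 0 \<or> z \<ge> 1" by linarith
      then have "real_of_int z \<le> -1 \<or> z = 0 \<or> real_of_int z \<ge> 1" by auto
      then show ?thesis by (auto simp: tent_def)
    qed
    ultimately show ?thesis by (auto simp del: of_int_add of_int_diff)
  qed
  have "bm W i ?t \<omega> = W i 0 0 \<omega> * ?t
      + (\<Sum>h<n. \<Sum>k = 1..2 ^ h. W i (Suc h) k \<omega> * (c h * tent (2 ^ h * ?t - real k + 1)))
      + (\<Sum>k = 1..2 ^ n. W i (Suc n) k \<omega> * (c n * (if k = Suc r then 1/2 else 0)))"
    unfolding bm_dyadic by (simp add: c_def fine)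
  also have "(\<Sum>k = 1..2 ^ n. W i (Suc n) k \<omega> * (c n * (if k = Suc r then 1/2 else 0)))
      = W i (Suc n) (Suc r) \<omega> * (c n / 2)"
  proof -
    have "(\<Sum>k = 1..2 ^ n. W i (Suc n) k \<omega> * (c n * (if k = Suc r then 1/2 else 0)))
      = (\<Sum>k = 1..2 ^ n. if k = Suc r then W i (Suc n) k \<omega> * (c n / 2) else 0)"
      by (intro sum.cong) auto
    also have "\<dots> = W i (Suc n) (Suc r) \<omega> * (c n / 2)"
      using assms by (subst sum.delta) auto
    finally show ?thesis .
  qed
  also have "(\<Sum>h<n. \<Sum>k = 1..2 ^ h. W i (Suc h) k \<omega> * (c h * tent (2 ^ h * ?t - real k + 1)))
      = ((\<Sum>h<n. \<Sum>k = 1..2 ^ h. W i (Suc h) k \<omega> * (c h * tent (2 ^ h * ?x - real k + 1)))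
       + (\<Sum>h<n. \<Sum>k = 1..2 ^ h. W i (Suc h) k \<omega> * (c h * tent (2 ^ h * ?y - real k + 1)))) / 2"
    by (simp add: coarse sum_divide_distrib add_divide_distrib distrib_left flip: sum.distrib)
  also have "c n = sqrt (\<Delta> n)"
  proof -
    have "2 powr (real n / 2) = sqrt (2 ^ n)"
      by (simp add: powr_half_sqrt[symmetric] powr_realpow[symmetric] powr_powr)
    then have "c n = sqrt (2 ^ n) / (sqrt (2 ^ n) * sqrt (2 ^ n))" by (simp add: c_def)
    also have "\<dots> = 1 / sqrt (2 ^ n)"
      unfolding divide_divide_eq_left[symmetric] by simp
    finally show ?thesis by (simp add: mesh_def real_sqrt_divide)
  qed
  also have "W i 0 0 \<omega> * ?t = (W i 0 0 \<omega> * ?x + W i 0 0 \<omega> * ?y) / 2"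
    unfolding t by (simp add: field_simps)
  finally show ?thesis
    unfolding bm_dyadic[of W i n] c_def[symmetric] by (simp add: field_simps)
qed

lemma incr_Suc_even:
  assumes "r < 2 ^ n"
  shows "incr W (Suc n) i (Suc (2 * r)) \<omega>
    = incr W n i (Suc r) \<omega> / 2 + sqrt (\<Delta> n) / 2 * W i (Suc n) (Suc r) \<omega>"
  using bm_midpoint[OF assms, of W i \<omega>] dyadic_Suc_double[of n r]
  by (simp add: incr_def field_simps)

lemma incr_Suc_odd:
  assumes "r < 2 ^ n"
  shows "incr W (Suc n) i (Suc (Suc (2 * r))) \<omega>
    = incr W n i (Suc r) \<omega> / 2 - sqrt (\<Delta> n) / 2 * W i (Suc n) (Suc r) \<omega>"
  using bm_midpoint[OF assms, of W i \<omega>] dyadic_Suc_double[of n "Suc r"]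
  by (simp add: incr_def field_simps)

section \<open>Increments as block means plus Brownian bridges\<close>

text \<open>
  The centred part of the level-\<open>(n + m)\<close> increment over the interval with number \<open>s\<close>, counted from
  \<open>0\<close>, as a function of the coefficients \<open>x (h, l)\<close> of the levels above \<open>n\<close>. Counting from \<open>0\<close>
  makes \<open>s div 2\<close> the parent interval; even \<open>s\<close> are left halves.
\<close>

fun bridge :: "nat \<Rightarrow> nat \<Rightarrow> (nat \<times> nat \<Rightarrow> real) \<Rightarrow> nat \<Rightarrow> real" where
  "bridge n 0 x s = 0"
| "bridge n (Suc m) x s = bridge n m x (s div 2) / 2
    + (-1) ^ s * (sqrt (\<Delta> (n + m)) / 2) * x (Suc (n + m), Suc (s div 2))"

definition fine_index :: "nat \<Rightarrow> nat \<Rightarrow> (nat \<times> nat) set"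
  where "fine_index n m = {(h, l). n < h \<and> h \<le> n + m \<and> l \<in> {1..2 ^ (h - 1)}}"

lemma fine_index_0 [simp]: "fine_index n 0 = {}"
  by (auto simp: fine_index_def)

lemma fine_index_Suc:
  "fine_index n (Suc m) = fine_index n m \<union> (\<lambda>r. (Suc (n + m), Suc r)) ` {..<2 ^ (n + m)}"
proof (intro set_eqI iffI)
  fix e assume "e \<in> fine_index n (Suc m)"
  then obtain h l where e: "e = (h, l)" "n < h" "h \<le> Suc (n + m)" "l \<in> {1..2 ^ (h - 1)}"
    by (auto simp: fine_index_def)
  show "e \<in> fine_index n m \<union> (\<lambda>r. (Suc (n + m), Suc r)) ` {..<2 ^ (n + m)}"
  proof (cases "h = Suc (n + m)")
    case True
    then have "e = (Suc (n + m), Suc (l - 1))" "l - 1 < 2 ^ (n + m)" using e by auto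
    then show ?thesis by blast
  qed (use e in \<open>auto simp: fine_index_def\<close>)
qed (auto simp: fine_index_def)

lemma finite_fine_index [simp]: "finite (fine_index n m)"
  by (induction m) (auto simp: fine_index_Suc)

lemma incr_eq_bridge:
  assumes "s < 2 ^ (n + m)"
  shows "incr W (n + m) i (Suc s) \<omega>
    = incr W n i (Suc (s div 2 ^ m)) \<omega> / 2 ^ m + bridge n m (\<lambda>(h, l). W i h l \<omega>) s"
  using assms
proof (induction m arbitrary: s)
  case (Suc m)
  define r where "r = s div 2"
  have r: "r < 2 ^ (n + m)" using Suc.prems by (auto simp: r_def)
  have "s div 2 ^ Suc m = r div 2 ^ m"
    by (simp add: r_def div_mult2_eq)
  moreover have "incr W (Suc (n + m)) i (Suc s) \<omega> = incr W (n + m) i (Suc r) \<omega> / 2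
      + (-1) ^ s * (sqrt (\<Delta> (n + m)) / 2) * W i (Suc (n + m)) (Suc r) \<omega>"
  proof (cases "even s")
    case True
    then have "s = 2 * r" by (simp add: r_def)
    then show ?thesis using incr_Suc_even[OF r, of W i \<omega>] by simp
  next
    case False
    then have "s = Suc (2 * r)" by (simp add: r_def)
    then show ?thesis using incr_Suc_odd[OF r, of W i \<omega>] by simp
  qed
  ultimately show ?case
    using Suc.IH[OF r] by (simp add: r_def[symmetric] add_divide_distrib)
qed simp

lemma sum_lessThan_double:
  fixes f :: "nat \<Rightarrow> 'a :: comm_monoid_add"
  shows "(\<Sum>s<2 * n. f s) = (\<Sum>r<n. f (2 * r) + f (Suc (2 * r)))"
  by (induction n) (auto simp: algebra_simps)

text \<open>
  The covariance matrix of the bridge increments is at most \<open>\<Delta> (n + m)\<close> times the identity, in the form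
  of a bound for the coefficients of every linear functional. In the step from one level to the next
  the weights \<open>w (2 * r)\<close>, \<open>w (2 * r + 1)\<close> enter only through their mean, which acts on the coarser
  bridge, and their difference, which multiplies the new coefficient; the parallelogram identity
  then closes the induction.
\<close>

lemma bridge_linear:
  "\<exists>a. (\<forall>x. (\<Sum>s<2 ^ (n + m). w s * bridge n m x s) = (\<Sum>e\<in>fine_index n m. a e * x e))
    \<and> (\<Sum>e\<in>fine_index n m. (a e)\<^sup>2) \<le> \<Delta> (n + m) * (\<Sum>s<2 ^ (n + m). (w s)\<^sup>2)"
proof (induction m arbitrary: w)
  case 0
  show ?case by (auto simp: mesh_def intro!: sum_nonneg divide_nonneg_nonneg)
next
  case (Suc m)
  define N where "N = n + m"
  define c where "c = sqrt (\<Delta> N) / 2"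
  obtain a where a: "(\<Sum>r<2 ^ N. (w (2 * r) + w (Suc (2 * r))) / 2 * bridge n m x r)
        = (\<Sum>e\<in>fine_index n m. a e * x e)"
    and a_le: "(\<Sum>e\<in>fine_index n m. (a e)\<^sup>2)
      \<le> \<Delta> N * (\<Sum>r<2 ^ N. ((w (2 * r) + w (Suc (2 * r))) / 2)\<^sup>2)" for x
    using Suc.IH[of "\<lambda>r. (w (2 * r) + w (Suc (2 * r))) / 2"] unfolding N_def by blast
  define b where "b e = (if fst e = Suc N
    then c * (w (2 * (snd e - 1)) - w (Suc (2 * (snd e - 1)))) else a e)" for e
  have split: "(\<Sum>e\<in>fine_index n (Suc m). f (b e) e) = (\<Sum>e\<in>fine_index n m. f (a e) e)
    + (\<Sum>r<2 ^ N. f (c * (w (2 * r) - w (Suc (2 * r)))) (Suc N, Suc r))" for f :: "real \<Rightarrow> _ \<Rightarrow> real"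
  proof -
    have "(\<Sum>e\<in>fine_index n (Suc m). f (b e) e) = (\<Sum>e\<in>fine_index n m. f (b e) e)
        + (\<Sum>e\<in>(\<lambda>r. (Suc (n + m), Suc r)) ` {..<2 ^ (n + m)}. f (b e) e)"
      unfolding fine_index_Suc
      by (intro sum.union_disjoint finite_fine_index finite_imageI) (auto simp: fine_index_def)
    also have "(\<Sum>e\<in>fine_index n m. f (b e) e) = (\<Sum>e\<in>fine_index n m. f (a e) e)"
      by (intro sum.cong) (auto simp: fine_index_def b_def N_def)
    also have "(\<Sum>e\<in>(\<lambda>r. (Suc (n + m), Suc r)) ` {..<2 ^ (n + m)}. f (b e) e)
        = (\<Sum>r<2 ^ N. f (c * (w (2 * r) - w (Suc (2 * r)))) (Suc N, Suc r))"
      by (subst sum.reindex) (auto simp: inj_on_def b_def N_def)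
    finally show ?thesis .
  qed
  have "(\<Sum>s<2 ^ (n + Suc m). w s * bridge n (Suc m) x s) = (\<Sum>e\<in>fine_index n (Suc m). b e * x e)" for x
  proof -
    have "(\<Sum>s<2 ^ (n + Suc m). w s * bridge n (Suc m) x s)
        = (\<Sum>r<2 ^ N. (w (2 * r) + w (Suc (2 * r))) / 2 * bridge n m x r
          + c * (w (2 * r) - w (Suc (2 * r))) * x (Suc N, Suc r))"
      unfolding add_Suc_right power_Suc sum_lessThan_double N_def[symmetric]
      by (intro sum.cong) (auto simp: N_def c_def field_simps)
    also have "\<dots> = (\<Sum>e\<in>fine_index n (Suc m). b e * x e)"
      by (simp only: sum.distrib a split[of "\<lambda>u e. u * x e"])
    finally show ?thesis .
  qed
  moreover have "(\<Sum>e\<in>fine_index n (Suc m). (b e)\<^sup>2) \<le> \<Delta> (n + Suc m) * (\<Sum>s<2 ^ (n + Suc m). (w s)\<^sup>2)"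
  proof -
    have c2: "c\<^sup>2 = \<Delta> N / 4" by (simp add: c_def power_divide mesh_def)
    have "(\<Sum>e\<in>fine_index n (Suc m). (b e)\<^sup>2)
        \<le> \<Delta> N * (\<Sum>r<2 ^ N. ((w (2 * r) + w (Suc (2 * r))) / 2)\<^sup>2)
          + (\<Sum>r<2 ^ N. (c * (w (2 * r) - w (Suc (2 * r))))\<^sup>2)"
      using a_le by (simp add: split[of "\<lambda>u e. u\<^sup>2"])
    also have "\<dots> = (\<Sum>r<2 ^ N. \<Delta> N / 2 * ((w (2 * r))\<^sup>2 + (w (Suc (2 * r)))\<^sup>2))"
      unfolding sum_distrib_left sum.distrib[symmetric] power_mult_distrib c2
      by (intro sum.cong) (auto simp: power2_eq_square field_simps)
    also have "\<dots> = \<Delta> (n + Suc m) * (\<Sum>s<2 ^ (n + Suc m). (w s)\<^sup>2)"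
      unfolding add_Suc_right power_Suc sum_lessThan_double N_def[symmetric]
      by (simp add: sum_distrib_left mesh_def mult.commute)
    finally show ?thesis .
  qed
  ultimately show ?case by blast
qed

text \<open>
  The area sums use every other increment of each coordinate only; the weights of the remaining
  intervals are set to \<open>0\<close>.
\<close>

lemma bridge_linear_on:
  assumes "finite R" "inj_on f R" "f ` R \<subseteq> {..<2 ^ (n + m)}"
  obtains a where "\<And>x. (\<Sum>r\<in>R. w r * bridge n m x (f r)) = (\<Sum>e\<in>fine_index n m. a e * x e)"
    and "(\<Sum>e\<in>fine_index n m. (a e)\<^sup>2) \<le> \<Delta> (n + m) * (\<Sum>r\<in>R. (w r)\<^sup>2)"
proof -
  define v where "v s = (if s \<in> f ` R then w (the_inv_into R f s) else 0)" for s
  have v: "(\<Sum>s<2 ^ (n + m). g (v s) s) = (\<Sum>r\<in>R. g (w r) (f r))" if "\<And>s. g 0 s = 0" for g :: "real \<Rightarrow> nat \<Rightarrow> real"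
  proof -
    have "(\<Sum>s<2 ^ (n + m). g (v s) s) = (\<Sum>s\<in>f ` R. g (v s) s)"
      using assms(3) that by (intro sum.mono_neutral_right) (auto simp: v_def)
    also have "\<dots> = (\<Sum>r\<in>R. g (w r) (f r))"
      using assms(2) by (subst sum.reindex) (auto simp: v_def the_inv_into_f_f intro!: sum.cong)
    finally show ?thesis .
  qed
  obtain a where a: "\<And>x. (\<Sum>s<2 ^ (n + m). v s * bridge n m x s) = (\<Sum>e\<in>fine_index n m. a e * x e)"
    "(\<Sum>e\<in>fine_index n m. (a e)\<^sup>2) \<le> \<Delta> (n + m) * (\<Sum>s<2 ^ (n + m). (v s)\<^sup>2)"
    using bridge_linear[where n = n and m = m and w = v] by blast
  show thesis
  proof (rule that)
    show "(\<Sum>r\<in>R. w r * bridge n m x (f r)) = (\<Sum>e\<in>fine_index n m. a e * x e)" for x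
      using v[of "\<lambda>u s. u * bridge n m x s"] a(1) by simp
    show "(\<Sum>e\<in>fine_index n m. (a e)\<^sup>2) \<le> \<Delta> (n + m) * (\<Sum>r\<in>R. (w r)\<^sup>2)"
      using v[of "\<lambda>u s. u\<^sup>2"] a(2) by simp
  qed
qed

lemma measurable_bm_dyadic:
  assumes "W i 0 0 \<in> borel_measurable N"
    and "\<And>h l. h < n \<Longrightarrow> l \<in> {1..2 ^ h} \<Longrightarrow> W i (Suc h) l \<in> borel_measurable N"
  shows "bm W i (dyadic n r) \<in> borel_measurable N"
  unfolding bm_dyadic
  by (intro borel_measurable_add borel_measurable_sum borel_measurable_times assms) auto

lemma measurable_incr:
  assumes "W i 0 0 \<in> borel_measurable N"
    and "\<And>h l. h < n \<Longrightarrow> l \<in> {1..2 ^ h} \<Longrightarrow> W i (Suc h) l \<in> borel_measurable N"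
  shows "incr W n i r \<in> borel_measurable N"
  unfolding incr_def by (intro borel_measurable_diff measurable_bm_dyadic assms)

lemma incr_cong:
  assumes "W i 0 0 \<omega> = W' i 0 0 \<omega>'"
    and "\<And>h l. h < n \<Longrightarrow> l \<in> {1..2 ^ h} \<Longrightarrow> W i (Suc h) l \<omega> = W' i (Suc h) l \<omega>'"
  shows "incr W n i r \<omega> = incr W' n i r \<omega>'"
  using assms by (simp add: incr_def bm_dyadic)

lemma bridge_eq_sum:
  assumes "s < 2 ^ (n + m)"
  obtains a where "\<And>x. bridge n m x s = (\<Sum>e\<in>fine_index n m. a e * x e)"
  using bridge_linear_on[of "{s}" id n m "\<lambda>_. 1"] assms by auto

lemma bridge_cong:
  assumes "s < 2 ^ (n + m)" "\<And>e. e \<in> fine_index n m \<Longrightarrow> x e = y e"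
  shows "bridge n m x s = bridge n m y s"
  using bridge_eq_sum[OF assms(1)] assms(2) by (metis (no_types, lifting) sum.cong)

lemma measurable_bridge:
  assumes "s < 2 ^ (n + m)" "\<And>e. e \<in> fine_index n m \<Longrightarrow> (\<lambda>\<omega>. X \<omega> e) \<in> borel_measurable N"
  shows "(\<lambda>\<omega>. bridge n m (X \<omega>) s) \<in> borel_measurable N"
proof -
  obtain a where a: "\<And>x. bridge n m x s = (\<Sum>e\<in>fine_index n m. a e * x e)"
    using bridge_eq_sum[OF assms(1)] by blast
  show ?thesis unfolding a using assms(2) by (intro borel_measurable_sum borel_measurable_times) auto
qed

text \<open>
  Summand \<open>r\<close>, counted from \<open>0\<close>, pairs the two halves of one level-\<open>(n + m - 1)\<close> interval, so because of
  \<open>m \<ge> 1\<close> both lie in the same level-\<open>n\<close> block \<open>r div 2 ^ (m - 1)\<close>.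
\<close>

lemma area_sum_diff:
  assumes "1 \<le> m" "k < k'" "k' \<le> 2 ^ (n + m - 1)"
  shows "area_sum W (n + m) i j k' \<omega> - area_sum W (n + m) i j k \<omega>
    = (\<Sum>r\<in>{k..<k'}.
      (incr W n i (Suc (r div 2 ^ (m - 1))) \<omega> / 2 ^ m + bridge n m (\<lambda>(h, l). W i h l \<omega>) (2 * r))
      * (incr W n j (Suc (r div 2 ^ (m - 1))) \<omega> / 2 ^ m + bridge n m (\<lambda>(h, l). W j h l \<omega>) (Suc (2 * r))))"
proof -
  define f where "f r = incr W (n + m) i (2 * r - 1) \<omega> * incr W (n + m) j (2 * r) \<omega>" for r
  obtain m' where m': "m = Suc m'" using assms(1) by (cases m) auto
  have area: "area_sum W (n + m) i j k \<omega> = (\<Sum>r\<in>{0..<k}. f (Suc r))" for k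
    unfolding area_sum_def f_def[symmetric] by (induction k) auto
  have "area_sum W (n + m) i j k' \<omega> - area_sum W (n + m) i j k \<omega> = (\<Sum>r\<in>{k..<k'}. f (Suc r))"
    unfolding area using assms(2) sum.atLeastLessThan_concat[of 0 k k' "\<lambda>r. f (Suc r)"] by simp
  also have "\<dots> = (\<Sum>r\<in>{k..<k'}.
      (incr W n i (Suc (r div 2 ^ (m - 1))) \<omega> / 2 ^ m + bridge n m (\<lambda>(h, l). W i h l \<omega>) (2 * r))
      * (incr W n j (Suc (r div 2 ^ (m - 1))) \<omega> / 2 ^ m + bridge n m (\<lambda>(h, l). W j h l \<omega>) (Suc (2 * r))))"
  proof (intro sum.cong refl)
    fix r assume "r \<in> {k..<k'}"
    then have "r < 2 ^ (n + m')" using assms(3) by (simp add: m')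
    then have bounds: "2 * r < 2 ^ (n + m)" "Suc (2 * r) < 2 ^ (n + m)" by (auto simp: m')
    have "2 * r div 2 ^ m = r div 2 ^ (m - 1)" "Suc (2 * r) div 2 ^ m = r div 2 ^ (m - 1)"
      by (simp_all add: m' div_mult2_eq)
    then show "f (Suc r)
      = (incr W n i (Suc (r div 2 ^ (m - 1))) \<omega> / 2 ^ m + bridge n m (\<lambda>(h, l). W i h l \<omega>) (2 * r))
      * (incr W n j (Suc (r div 2 ^ (m - 1))) \<omega> / 2 ^ m + bridge n m (\<lambda>(h, l). W j h l \<omega>) (Suc (2 * r)))"
      using incr_eq_bridge[OF bounds(1), of W i \<omega>] incr_eq_bridge[OF bounds(2), of W j \<omega>]
      by (simp add: f_def)
  qed
  finally show ?thesis .
qed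

section \<open>Exponential moments of Gaussian bilinear forms\<close>

text \<open>
  Completing the square turns the integrand into a multiple of a normal density with variance
  \<open>1 / (1 - a\<^sup>2)\<close>.
\<close>

lemma nn_integral_gauss_exp_quadratic:
  fixes a u v :: real
  assumes "a\<^sup>2 < 1"
  shows "(\<integral>\<^sup>+z. exp (u * z + (a * z + v)\<^sup>2 / 2) \<partial>density lborel std_normal_density)
    = ennreal (1 / sqrt (1 - a\<^sup>2) * exp ((u\<^sup>2 + v\<^sup>2 + 2 * a * u * v) / (2 * (1 - a\<^sup>2))))"
proof -
  define D where "D = 1 - a\<^sup>2"
  define \<mu> where "\<mu> = (u + a * v) / D"
  define K where "K = 1 / sqrt D * exp ((u\<^sup>2 + v\<^sup>2 + 2 * a * u * v) / (2 * D))"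
  have D: "D > 0" using assms by (simp add: D_def)
  have complete_square: "- z\<^sup>2 / 2 + (u * z + (a * z + v)\<^sup>2 / 2)
      = (u\<^sup>2 + v\<^sup>2 + 2 * a * u * v) / (2 * D) - D * (z - \<mu>)\<^sup>2 / 2" for z
  proof -
    have "2 * D * (- z\<^sup>2 / 2 + (u * z + (a * z + v)\<^sup>2 / 2))
        = u\<^sup>2 + v\<^sup>2 + 2 * a * u * v - (D * z - (u + a * v))\<^sup>2"
      by (simp add: D_def power2_eq_square field_simps)
    also have "D * z - (u + a * v) = D * (z - \<mu>)" using D by (simp add: \<mu>_def field_simps)
    finally show ?thesis using D by (simp add: field_simps power2_eq_square)
  qed
  have dens: "std_normal_density z * exp (u * z + (a * z + v)\<^sup>2 / 2) = K * normal_density \<mu> (1 / sqrt D) z" for z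
  proof -
    have "std_normal_density z * exp (u * z + (a * z + v)\<^sup>2 / 2)
        = 1 / sqrt (2 * pi) * exp (- z\<^sup>2 / 2 + (u * z + (a * z + v)\<^sup>2 / 2))"
      by (simp add: std_normal_density_def mult_exp_exp)
    also have "\<dots> = K * normal_density \<mu> (1 / sqrt D) z"
    proof -
      have "normal_density \<mu> (1 / sqrt D) z = sqrt D / sqrt (2 * pi) * exp (- (D * (z - \<mu>)\<^sup>2 / 2))"
        using D by (simp add: normal_density_def power_divide real_sqrt_divide field_simps)
      moreover have "exp (- z\<^sup>2 / 2 + (u * z + (a * z + v)\<^sup>2 / 2))
          = exp ((u\<^sup>2 + v\<^sup>2 + 2 * a * u * v) / (2 * D)) * exp (- (D * (z - \<mu>)\<^sup>2 / 2))"
        unfolding complete_square mult_exp_exp by simp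
      ultimately show ?thesis using D by (simp only: K_def) simp
    qed
    finally show ?thesis .
  qed
  have "(\<integral>\<^sup>+z. exp (u * z + (a * z + v)\<^sup>2 / 2) \<partial>density lborel std_normal_density)
      = (\<integral>\<^sup>+z. ennreal K * ennreal (normal_density \<mu> (1 / sqrt D) z) \<partial>lborel)"
    using D by (subst nn_integral_density) (auto simp: dens K_def simp flip: ennreal_mult)
  also have "\<dots> = ennreal K * (\<integral>\<^sup>+z. ennreal (normal_density \<mu> (1 / sqrt D) z) \<partial>lborel)"
    by (intro nn_integral_cmult) auto
  also have "(\<integral>\<^sup>+z. ennreal (normal_density \<mu> (1 / sqrt D) z) \<partial>lborel) = 1"
    using D prob_space.emeasure_space_1[OF prob_space_normal_density[of "1 / sqrt D" \<mu>]]
    by (simp add: emeasure_density)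
  finally show ?thesis by (simp add: K_def D_def)
qed

lemma nn_integral_gauss_exp:
  "(\<integral>\<^sup>+z. exp (t * z) \<partial>density lborel std_normal_density) = ennreal (exp (t\<^sup>2 / 2))"
  using nn_integral_gauss_exp_quadratic[of 0 t 0] by simp

lemma nn_integral_PiM_gauss_exp_quadratic:
  fixes u v :: "'r \<Rightarrow> real"
  assumes "finite R" "a\<^sup>2 < 1"
  shows "(\<integral>\<^sup>+z. exp (\<Sum>r\<in>R. u r * z r + (a * z r + v r)\<^sup>2 / 2) \<partial>PiM R (\<lambda>_. density lborel std_normal_density))
    = ennreal (\<Prod>r\<in>R. 1 / sqrt (1 - a\<^sup>2)
        * exp (((u r)\<^sup>2 + (v r)\<^sup>2 + 2 * a * u r * v r) / (2 * (1 - a\<^sup>2))))"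
proof -
  interpret G: prob_space "density lborel std_normal_density"
    by (rule prob_space_normal_density) simp
  interpret product_sigma_finite "\<lambda>_::'r. density lborel (\<lambda>x. ennreal (std_normal_density x))" ..
  have "(\<integral>\<^sup>+z. exp (\<Sum>r\<in>R. u r * z r + (a * z r + v r)\<^sup>2 / 2) \<partial>PiM R (\<lambda>_. density lborel std_normal_density))
    = (\<integral>\<^sup>+z. (\<Prod>r\<in>R. ennreal (exp (u r * z r + (a * z r + v r)\<^sup>2 / 2))) \<partial>PiM R (\<lambda>_. density lborel std_normal_density))"
    using assms(1) by (simp add: exp_sum prod_ennreal)
  also have "\<dots> = (\<Prod>r\<in>R. \<integral>\<^sup>+z. exp (u r * z + (a * z + v r)\<^sup>2 / 2) \<partial>density lborel std_normal_density)"
    using assms(1) by (intro product_nn_integral_prod) auto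
  also have "\<dots> = ennreal (\<Prod>r\<in>R. 1 / sqrt (1 - a\<^sup>2)
        * exp (((u r)\<^sup>2 + (v r)\<^sup>2 + 2 * a * u r * v r) / (2 * (1 - a\<^sup>2))))"
    using assms(2) by (simp add: nn_integral_gauss_exp_quadratic prod_ennreal)
  finally show ?thesis .
qed

lemma nn_integral_PiM_gauss_exp:
  assumes "finite R"
  shows "(\<integral>\<^sup>+z. exp (\<Sum>r\<in>R. t r * z r) \<partial>PiM R (\<lambda>_. density lborel std_normal_density))
    = ennreal (exp (\<Sum>r\<in>R. (t r)\<^sup>2 / 2))"
  using nn_integral_PiM_gauss_exp_quadratic[OF assms, of 0 t "\<lambda>_. 0"] assms by (simp add: exp_sum)

text \<open>
  Exponential moments of a decoupled bilinear form in two independent sub-Gaussian vectors, with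
  possibly nonzero means. Coordinates of one vector need not be independent of each other. The trick
  is to write the square that remains after the first integration as a Gaussian integral,
  \<open>exp (s\<^sup>2 / 2) = E (exp (s * z))\<close> with \<open>z\<close> standard normal: the sub-Gaussian bound can then be used for
  the second vector too, and the auxiliary vector has independent coordinates.
\<close>

lemma chaos_exp_bound:
  fixes P Q :: "('r \<Rightarrow> real) measure" and \<mu> \<nu> :: "'r \<Rightarrow> real"
  assumes "finite R" "sigma_finite_measure P" "sigma_finite_measure Q"
    and sets_eq_P: "sets P = sets (PiM R (\<lambda>_. borel))" and sets_eq_Q: "sets Q = sets (PiM R (\<lambda>_. borel))"
    and sub_P: "\<And>w. (\<integral>\<^sup>+x. exp (\<Sum>r\<in>R. w r * x r) \<partial>P) \<le> exp (\<sigma> / 2 * (\<Sum>r\<in>R. (w r)\<^sup>2))"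
    and sub_Q: "\<And>w. (\<integral>\<^sup>+y. exp (\<Sum>r\<in>R. w r * y r) \<partial>Q) \<le> exp (\<sigma> / 2 * (\<Sum>r\<in>R. (w r)\<^sup>2))"
    and \<sigma>: "0 < \<sigma>" and small: "\<bar>\<kappa> * \<sigma>\<bar> < 1"
    and \<mu>: "\<And>r. r \<in> R \<Longrightarrow> \<bar>\<mu> r\<bar> \<le> \<rho>" and \<nu>: "\<And>r. r \<in> R \<Longrightarrow> \<bar>\<nu> r\<bar> \<le> \<rho>"
  shows "(\<integral>\<^sup>+y. \<integral>\<^sup>+x. exp (\<kappa> * (\<Sum>r\<in>R. (\<mu> r + x r) * (\<nu> r + y r))) \<partial>P \<partial>Q)
    \<le> ennreal (exp (\<kappa> * (\<Sum>r\<in>R. \<mu> r * \<nu> r))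
        * (1 / sqrt (1 - (\<kappa> * \<sigma>)\<^sup>2) * exp (\<kappa>\<^sup>2 * \<sigma> * \<rho>\<^sup>2 / (1 - \<bar>\<kappa> * \<sigma>\<bar>))) ^ card R)"
proof -
  let ?G = "PiM R (\<lambda>_. density lborel (\<lambda>x. ennreal (std_normal_density x)))"
  define a where "a = \<kappa> * \<sigma>"
  define B where "B = \<kappa>\<^sup>2 * \<sigma> * \<rho>\<^sup>2"
  define c where "c = sqrt \<sigma> * \<kappa>"
  have c2: "c\<^sup>2 = \<sigma> * \<kappa>\<^sup>2" using \<sigma> by (simp add: c_def power_mult_distrib)
  have ca: "sqrt \<sigma> * c = a" using \<sigma> by (simp add: c_def a_def flip: mult.assoc)
  have a1: "\<bar>a\<bar> < 1" using small by (simp add: a_def)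
  then have a2: "a\<^sup>2 < 1" by (simp add: abs_square_less_1)
  interpret G1: prob_space "density lborel std_normal_density"
    by (rule prob_space_normal_density) simp
  interpret product_prob_space "\<lambda>_::'r. density lborel (\<lambda>x. ennreal (std_normal_density x))" R ..
  interpret Q: sigma_finite_measure Q by fact
  interpret QG: pair_sigma_finite ?G Q ..
  have sets_eq_G: "sets ?G = sets (PiM R (\<lambda>_. borel))" by (intro sets_PiM_cong) auto
  have comp: "(\<lambda>x. x r) \<in> borel_measurable N" if "sets N = sets (PiM R (\<lambda>_. borel))" "r \<in> R" for r N
    using that measurable_component_singleton[of r R "\<lambda>_. borel"] by (simp cong: measurable_cong_sets)
  note [measurable] = comp[OF sets_eq_G] comp[OF sets_eq_P] comp[OF sets_eq_Q]
  \<comment> \<open>Integrate \<open>x\<close> out, then linearise the square in \<open>y\<close> by the auxiliary vector \<open>z\<close>.\<close>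
  have first: "(\<integral>\<^sup>+x. exp (\<kappa> * (\<Sum>r\<in>R. (\<mu> r + x r) * (\<nu> r + y r))) \<partial>P)
      \<le> (\<integral>\<^sup>+z. exp (\<Sum>r\<in>R. (\<kappa> * \<mu> r + c * z r) * (\<nu> r + y r)) \<partial>?G)" for y
  proof -
    have "(\<integral>\<^sup>+x. exp (\<kappa> * (\<Sum>r\<in>R. (\<mu> r + x r) * (\<nu> r + y r))) \<partial>P)
      = (\<integral>\<^sup>+x. ennreal (exp (\<Sum>r\<in>R. \<kappa> * \<mu> r * (\<nu> r + y r)))
          * ennreal (exp (\<Sum>r\<in>R. (\<kappa> * (\<nu> r + y r)) * x r)) \<partial>P)"
      by (intro nn_integral_cong)
        (simp add: sum_distrib_left algebra_simps sum.distrib flip: ennreal_mult exp_add)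
    also have "\<dots> = ennreal (exp (\<Sum>r\<in>R. \<kappa> * \<mu> r * (\<nu> r + y r)))
        * (\<integral>\<^sup>+x. exp (\<Sum>r\<in>R. (\<kappa> * (\<nu> r + y r)) * x r) \<partial>P)"
      by (intro nn_integral_cmult) measurable
    also have "\<dots> \<le> ennreal (exp (\<Sum>r\<in>R. \<kappa> * \<mu> r * (\<nu> r + y r)))
        * ennreal (exp (\<sigma> / 2 * (\<Sum>r\<in>R. (\<kappa> * (\<nu> r + y r))\<^sup>2)))"
      by (intro mult_left_mono sub_P) auto
    also have "\<sigma> / 2 * (\<Sum>r\<in>R. (\<kappa> * (\<nu> r + y r))\<^sup>2) = (\<Sum>r\<in>R. (c * (\<nu> r + y r))\<^sup>2 / 2)"
      unfolding sum_distrib_left by (intro sum.cong) (simp_all add: power_mult_distrib c2)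
    also have "ennreal (exp (\<Sum>r\<in>R. (c * (\<nu> r + y r))\<^sup>2 / 2))
        = (\<integral>\<^sup>+z. exp (\<Sum>r\<in>R. c * (\<nu> r + y r) * z r) \<partial>?G)"
      using assms(1) by (simp add: nn_integral_PiM_gauss_exp)
    also have "ennreal (exp (\<Sum>r\<in>R. \<kappa> * \<mu> r * (\<nu> r + y r)))
          * (\<integral>\<^sup>+z. exp (\<Sum>r\<in>R. c * (\<nu> r + y r) * z r) \<partial>?G)
        = (\<integral>\<^sup>+z. ennreal (exp (\<Sum>r\<in>R. \<kappa> * \<mu> r * (\<nu> r + y r)))
          * ennreal (exp (\<Sum>r\<in>R. c * (\<nu> r + y r) * z r)) \<partial>?G)"
      by (intro nn_integral_cmult[symmetric]) measurable
    also have "\<dots> = (\<integral>\<^sup>+z. exp (\<Sum>r\<in>R. (\<kappa> * \<mu> r + c * z r) * (\<nu> r + y r)) \<partial>?G)"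
      by (intro nn_integral_cong)
        (simp add: algebra_simps sum.distrib flip: ennreal_mult exp_add)
    finally show ?thesis .
  qed
  \<comment> \<open>Integrate \<open>y\<close> out; what is left factorises over the coordinates of \<open>z\<close>.\<close>
  have second: "(\<integral>\<^sup>+y. exp (\<Sum>r\<in>R. (\<kappa> * \<mu> r + c * z r) * (\<nu> r + y r)) \<partial>Q)
      \<le> ennreal (exp (\<kappa> * (\<Sum>r\<in>R. \<mu> r * \<nu> r)))
        * ennreal (exp (\<Sum>r\<in>R. (c * \<nu> r) * z r + (a * z r + c * \<mu> r)\<^sup>2 / 2))" for z
  proof -
    have "(\<integral>\<^sup>+y. exp (\<Sum>r\<in>R. (\<kappa> * \<mu> r + c * z r) * (\<nu> r + y r)) \<partial>Q)
      = (\<integral>\<^sup>+y. ennreal (exp (\<Sum>r\<in>R. (\<kappa> * \<mu> r + c * z r) * \<nu> r))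
          * ennreal (exp (\<Sum>r\<in>R. (\<kappa> * \<mu> r + c * z r) * y r)) \<partial>Q)"
      by (intro nn_integral_cong)
        (simp add: algebra_simps sum.distrib flip: ennreal_mult exp_add)
    also have "\<dots> = ennreal (exp (\<Sum>r\<in>R. (\<kappa> * \<mu> r + c * z r) * \<nu> r))
        * (\<integral>\<^sup>+y. exp (\<Sum>r\<in>R. (\<kappa> * \<mu> r + c * z r) * y r) \<partial>Q)"
      by (intro nn_integral_cmult) measurable
    also have "\<dots> \<le> ennreal (exp (\<Sum>r\<in>R. (\<kappa> * \<mu> r + c * z r) * \<nu> r))
        * ennreal (exp (\<sigma> / 2 * (\<Sum>r\<in>R. (\<kappa> * \<mu> r + c * z r)\<^sup>2)))"
      by (intro mult_left_mono sub_Q) auto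
    also have "\<sigma> / 2 * (\<Sum>r\<in>R. (\<kappa> * \<mu> r + c * z r)\<^sup>2) = (\<Sum>r\<in>R. (a * z r + c * \<mu> r)\<^sup>2 / 2)"
    proof -
      have "sqrt \<sigma> * (\<kappa> * \<mu> r + c * z r) = a * z r + c * \<mu> r" for r
        unfolding ca[symmetric] by (simp add: c_def algebra_simps)
      moreover have "\<sigma> * (\<kappa> * \<mu> r + c * z r)\<^sup>2 = (sqrt \<sigma> * (\<kappa> * \<mu> r + c * z r))\<^sup>2" for r
        using \<sigma> by (simp add: power_mult_distrib)
      ultimately show ?thesis by (simp add: sum_distrib_left)
    qed
    finally show ?thesis
      by (simp add: sum_distrib_left algebra_simps sum.distrib flip: ennreal_mult exp_add)
  qed
  have "(\<integral>\<^sup>+y. \<integral>\<^sup>+x. exp (\<kappa> * (\<Sum>r\<in>R. (\<mu> r + x r) * (\<nu> r + y r))) \<partial>P \<partial>Q)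
      \<le> (\<integral>\<^sup>+y. \<integral>\<^sup>+z. exp (\<Sum>r\<in>R. (\<kappa> * \<mu> r + c * z r) * (\<nu> r + y r)) \<partial>?G \<partial>Q)"
    by (intro nn_integral_mono first)
  also have "\<dots> = (\<integral>\<^sup>+z. \<integral>\<^sup>+y. exp (\<Sum>r\<in>R. (\<kappa> * \<mu> r + c * z r) * (\<nu> r + y r)) \<partial>Q \<partial>?G)"
  proof (rule QG.Fubini')
    show "(\<lambda>(z, y). ennreal (exp (\<Sum>r\<in>R. (\<kappa> * \<mu> r + c * z r) * (\<nu> r + y r)))) \<in> borel_measurable (?G \<Otimes>\<^sub>M Q)"
      by measurable
  qed
  also have "\<dots> \<le> (\<integral>\<^sup>+z. ennreal (exp (\<kappa> * (\<Sum>r\<in>R. \<mu> r * \<nu> r)))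
        * ennreal (exp (\<Sum>r\<in>R. (c * \<nu> r) * z r + (a * z r + c * \<mu> r)\<^sup>2 / 2)) \<partial>?G)"
    by (intro nn_integral_mono second)
  also have "\<dots> = ennreal (exp (\<kappa> * (\<Sum>r\<in>R. \<mu> r * \<nu> r)))
      * (\<integral>\<^sup>+z. exp (\<Sum>r\<in>R. (c * \<nu> r) * z r + (a * z r + c * \<mu> r)\<^sup>2 / 2) \<partial>?G)"
    by (intro nn_integral_cmult) measurable
  also have "\<dots> = ennreal (exp (\<kappa> * (\<Sum>r\<in>R. \<mu> r * \<nu> r)) * (\<Prod>r\<in>R. 1 / sqrt (1 - a\<^sup>2)
        * exp (((c * \<nu> r)\<^sup>2 + (c * \<mu> r)\<^sup>2 + 2 * a * (c * \<nu> r) * (c * \<mu> r)) / (2 * (1 - a\<^sup>2)))))"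
    unfolding nn_integral_PiM_gauss_exp_quadratic[OF assms(1) a2] using a2
    by (subst ennreal_mult) (auto intro!: prod_nonneg)
  also have "\<dots> \<le> ennreal (exp (\<kappa> * (\<Sum>r\<in>R. \<mu> r * \<nu> r)) * (\<Prod>r\<in>R. 1 / sqrt (1 - a\<^sup>2) * exp (B / (1 - \<bar>a\<bar>))))"
  proof (intro ennreal_leI mult_left_mono prod_mono conjI)
    fix r assume r: "r \<in> R"
    define u v where "u = c * \<nu> r" and "v = c * \<mu> r"
    have B: "u\<^sup>2 \<le> B" "v\<^sup>2 \<le> B"
      using \<mu>[OF r] \<nu>[OF r] \<sigma> power_mono[OF \<mu>[OF r], of 2] power_mono[OF \<nu>[OF r], of 2]
      by (auto simp: u_def v_def B_def power_mult_distrib c2 mult_ac intro!: mult_left_mono)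
    have "2 * \<bar>u * v\<bar> \<le> u\<^sup>2 + v\<^sup>2"
      using sum_squares_bound[of "\<bar>u\<bar>" "\<bar>v\<bar>"] by (simp add: abs_mult)
    then have "\<bar>u * v\<bar> \<le> B" using B by linarith
    then have "\<bar>a * (u * v)\<bar> \<le> \<bar>a\<bar> * B" by (simp add: abs_mult mult_left_mono)
    then have "u\<^sup>2 + v\<^sup>2 + 2 * a * u * v \<le> 2 * B * (1 + \<bar>a\<bar>)"
      using B by (simp add: algebra_simps)
    then have "(u\<^sup>2 + v\<^sup>2 + 2 * a * u * v) / (2 * (1 - a\<^sup>2)) \<le> 2 * B * (1 + \<bar>a\<bar>) / (2 * (1 - a\<^sup>2))"
      using a2 by (intro divide_right_mono) auto
    also have "2 * B * (1 + \<bar>a\<bar>) / (2 * (1 - a\<^sup>2)) = B / (1 - \<bar>a\<bar>)"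
    proof -
      have "1 - a\<^sup>2 = (1 + \<bar>a\<bar>) * (1 - \<bar>a\<bar>)" by (simp add: algebra_simps power2_eq_square)
      then show ?thesis using a1 by (simp add: divide_simps)
    qed
    finally show "exp (((c * \<nu> r)\<^sup>2 + (c * \<mu> r)\<^sup>2 + 2 * a * (c * \<nu> r) * (c * \<mu> r)) / (2 * (1 - a\<^sup>2)))
      \<le> exp (B / (1 - \<bar>a\<bar>))"
      by (simp add: u_def v_def)
  qed (use a2 in auto)
  finally show ?thesis by (simp add: a_def B_def)
qed

section \<open>Conditional probabilities by freezing\<close>

text \<open>
  Test the bound on the part of \<open>E\<close> where it fails: this set belongs to \<open>F\<close>, so the averaging property
  of conditional expectation applies and forces it to be a null set.
\<close>

lemma cond_prob_given_le:
  assumes "prob_space M" "subalgebra M F" and A: "A \<in> sets M" and E: "E \<in> sets F"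
    and le: "\<And>B. B \<in> sets F \<Longrightarrow> B \<subseteq> E \<Longrightarrow> measure M (A \<inter> B) \<le> C * measure M B"
  shows "AE \<omega> in M. \<omega> \<in> E \<longrightarrow> cond_prob_given M F A \<omega> \<le> C"
proof -
  interpret prob_space M by fact
  interpret finite_measure_subalgebra M F by standard fact
  define g where "g = cond_prob_given M F A"
  have A_int: "integrable M (indicat_real A)" using A by (simp add: integrable_real_indicator emeasure_finite less_top[symmetric])
  have g_int: "integrable M g" unfolding g_def cond_prob_given_def by (rule real_cond_exp_int(1)[OF A_int])
  have g_F: "g \<in> borel_measurable F" unfolding g_def cond_prob_given_def by (rule borel_measurable_cond_exp)
  define B where "B = E \<inter> {\<omega> \<in> space F. C < g \<omega>}"
  have B: "B \<in> sets F" "B \<subseteq> E" unfolding B_def using E g_F by auto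
  have BM: "B \<in> sets M" using B(1) assms(2) by (auto simp: subalgebra_def)
  have "(\<integral>\<omega>. indicator B \<omega> * g \<omega> \<partial>M) = measure M (A \<inter> B)"
    using real_cond_exp_intA[OF A_int B(1)] A BM
    by (simp add: set_lebesgue_integral_def g_def cond_prob_given_def
        flip: indicator_inter_arith) (simp add: Int_commute Int_absorb2 sets.sets_into_space)
  also have "\<dots> \<le> C * measure M B" by (rule le[OF B])
  finally have "(\<integral>\<omega>. indicator B \<omega> * g \<omega> \<partial>M) - (\<integral>\<omega>. C * indicator B \<omega> \<partial>M) \<le> 0"
    using BM by simp
  moreover have ints: "integrable M (\<lambda>\<omega>. indicator B \<omega> * g \<omega>)" "integrable M (\<lambda>\<omega>. C * indicat_real B \<omega>)"
    using integrable_real_mult_indicator[OF BM g_int] BM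
    by (simp_all add: mult.commute integrable_real_indicator emeasure_finite less_top[symmetric])
  ultimately have "(\<integral>\<omega>. indicator B \<omega> * g \<omega> - C * indicator B \<omega> \<partial>M) \<le> 0"
    by simp
  moreover have nonneg: "0 \<le> indicator B \<omega> * g \<omega> - C * indicator B \<omega>" for \<omega>
    by (auto simp: B_def indicator_def)
  ultimately have "(\<integral>\<omega>. indicator B \<omega> * g \<omega> - C * indicator B \<omega> \<partial>M) = 0"
    by (intro antisym integral_nonneg) auto
  then have "AE \<omega> in M. indicator B \<omega> * g \<omega> - C * indicator B \<omega> = 0"
    using nonneg ints by (subst (asm) integral_nonneg_eq_0_iff_AE) auto
  then show ?thesis
    using AE_space
  proof eventually_elim
    case (elim \<omega>)
    moreover have "space F = space M" using assms(2) by (simp add: subalgebra_def)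
    ultimately show ?case by (force simp: B_def g_def indicator_def split: if_splits)
  qed
qed

text \<open>
  Freezing: if \<open>F\<close> is generated by \<open>U\<close> and \<open>V\<close> is independent of \<open>U\<close>, conditioning on \<open>F\<close> amounts to
  fixing the value of \<open>U\<close>. The joint law of \<open>U\<close> and \<open>V\<close> is a product, so a bound that is
  uniform over the frozen values in \<open>G\<close> can be integrated over every \<open>F\<close>-measurable part of the event
  that \<open>U\<close> lies in \<open>G\<close>.
\<close>

lemma cond_prob_given_le_freezing:
  assumes "prob_space M" and sub: "subalgebra M F" and indep: "prob_space.indep_var M N\<^sub>1 U N\<^sub>2 V"
    and U: "U \<in> measurable F N\<^sub>1" and F: "sets F \<subseteq> sets (vimage_algebra (space M) U N\<^sub>1)"
    and Q: "Q \<in> sets (N\<^sub>1 \<Otimes>\<^sub>M N\<^sub>2)" and G: "G \<in> sets N\<^sub>1" and "0 \<le> C"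
    and le: "\<And>u. u \<in> G \<Longrightarrow> measure M {\<omega> \<in> space M. (u, V \<omega>) \<in> Q} \<le> C"
  shows "AE \<omega> in M. U \<omega> \<in> G \<longrightarrow> cond_prob_given M F {\<omega> \<in> space M. (U \<omega>, V \<omega>) \<in> Q} \<omega> \<le> C"
proof -
  interpret prob_space M by fact
  have rv[measurable]: "U \<in> measurable M N\<^sub>1" "V \<in> measurable M N\<^sub>2"
    using indep_var_rv1[OF indep] indep_var_rv2[OF indep] .
  interpret V: prob_space "distr M N\<^sub>2 V" by (rule prob_space_distr) simp
  have law: "distr M (N\<^sub>1 \<Otimes>\<^sub>M N\<^sub>2) (\<lambda>\<omega>. (U \<omega>, V \<omega>)) = distr M N\<^sub>1 U \<Otimes>\<^sub>M distr M N\<^sub>2 V"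
    using indep_var_distribution_eq[THEN iffD1, OF indep] by simp
  have space: "space F = space M" using sub by (simp add: subalgebra_def)
  let ?A = "{\<omega> \<in> space M. (U \<omega>, V \<omega>) \<in> Q}"
  have "AE \<omega> in M. \<omega> \<in> U -` G \<inter> space F \<longrightarrow> cond_prob_given M F ?A \<omega> \<le> C"
  proof (rule cond_prob_given_le[OF assms(1) sub])
    show "?A \<in> sets M" using Q by measurable
    show "U -` G \<inter> space F \<in> sets F" using U G by (rule measurable_sets)
    fix B assume B: "B \<in> sets F" "B \<subseteq> U -` G \<inter> space F"
    have "U \<in> space M \<rightarrow> space N\<^sub>1" using rv(1) by (rule measurable_space[THEN funcsetI])
    then obtain B' where B': "B' \<in> sets N\<^sub>1" "B = U -` B' \<inter> space M"
      using B(1) F by (auto simp: sets_vimage_algebra2)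
    define H where "H = B' \<inter> G"
    have H: "H \<in> sets N\<^sub>1" "H \<subseteq> G" "B = U -` H \<inter> space M" using B B' G by (auto simp: H_def)
    have QH: "Q \<inter> H \<times> space N\<^sub>2 \<in> sets (N\<^sub>1 \<Otimes>\<^sub>M N\<^sub>2)" using Q H(1) by auto
    have "?A \<inter> B = (\<lambda>\<omega>. (U \<omega>, V \<omega>)) -` (Q \<inter> H \<times> space N\<^sub>2) \<inter> space M"
      using H(3) rv(2)[THEN measurable_space] by auto
    then have "emeasure M (?A \<inter> B) = emeasure (distr M N\<^sub>1 U \<Otimes>\<^sub>M distr M N\<^sub>2 V) (Q \<inter> H \<times> space N\<^sub>2)"
      unfolding law[symmetric] using QH by (subst emeasure_distr) auto
    also have "\<dots> = (\<integral>\<^sup>+u. emeasure (distr M N\<^sub>2 V) (Pair u -` (Q \<inter> H \<times> space N\<^sub>2)) \<partial>distr M N\<^sub>1 U)"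
      using QH by (intro V.emeasure_pair_measure_alt) (simp cong: sets_pair_measure_cong)
    also have "\<dots> \<le> (\<integral>\<^sup>+u. ennreal C * indicator H u \<partial>distr M N\<^sub>1 U)"
    proof (rule nn_integral_mono)
      fix u
      show "emeasure (distr M N\<^sub>2 V) (Pair u -` (Q \<inter> H \<times> space N\<^sub>2)) \<le> ennreal C * indicator H u"
      proof (cases "u \<in> H")
        case True
        have "Pair u -` (Q \<inter> H \<times> space N\<^sub>2) \<in> sets N\<^sub>2" by (rule sets_Pair1[OF QH])
        then have "emeasure (distr M N\<^sub>2 V) (Pair u -` (Q \<inter> H \<times> space N\<^sub>2))
            = emeasure M (V -` (Pair u -` (Q \<inter> H \<times> space N\<^sub>2)) \<inter> space M)"
          by (simp add: emeasure_distr)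
        also have "V -` (Pair u -` (Q \<inter> H \<times> space N\<^sub>2)) \<inter> space M = {\<omega> \<in> space M. (u, V \<omega>) \<in> Q}"
          using True rv(2)[THEN measurable_space] by auto
        also have "emeasure M \<dots> \<le> ennreal C"
          using le[of u] H(2) True by (auto simp: emeasure_eq_measure intro: ennreal_leI)
        finally show ?thesis using True by simp
      qed auto
    qed
    also have "\<dots> = ennreal C * emeasure M B"
      using H by (simp add: nn_integral_cmult_indicator emeasure_distr)
    finally show "measure M (?A \<inter> B) \<le> C * measure M B"
      using \<open>0 \<le> C\<close> by (simp add: emeasure_eq_measure flip: ennreal_mult)
  qed
  then show ?thesis
    using AE_space by eventually_elim (simp add: space)
qed

section \<open>Elementary estimates\<close>

text \<open>
  A range of indices consists of complete blocks of length \<open>B\<close> and at most two incomplete ones. Each of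
  the latter has at most \<open>B - 1\<close> elements; this count is \<open>0\<close> if \<open>B = 1\<close>, which is essential for the
  constants in \<open>mean_numeric_bound\<close>.
\<close>

lemma abs_sum_div_le:
  fixes c :: "nat \<Rightarrow> real"
  assumes "0 < B" "k < k'" "k' \<le> B * P"
    and small: "\<And>p. p < P \<Longrightarrow> \<bar>c p\<bar> \<le> y"
    and blocks: "\<And>l q. l < q \<Longrightarrow> q \<le> P \<Longrightarrow> B * (q - l) \<le> k' - k \<Longrightarrow> \<bar>\<Sum>p\<in>{l..<q}. c p\<bar> \<le> z"
    and "0 \<le> z"
  shows "\<bar>\<Sum>r\<in>{k..<k'}. c (r div B)\<bar> \<le> real (min (k' - k) (2 * (B - 1))) * y + real B * z"
proof -
  have y: "0 \<le> y" using small[of 0] assms(1-3) by (cases P) auto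
  have part: "\<bar>\<Sum>r\<in>{s..<t}. c (r div B)\<bar> \<le> real (t - s) * y" if "t \<le> k'" for s t
  proof -
    have "\<bar>\<Sum>r\<in>{s..<t}. c (r div B)\<bar> \<le> (\<Sum>r\<in>{s..<t}. y)"
    proof (rule order.trans[OF sum_abs sum_mono])
      fix r assume "r \<in> {s..<t}"
      then have "r div B < P" using assms that by (intro less_mult_imp_div_less) (auto simp: mult.commute)
      then show "\<bar>c (r div B)\<bar> \<le> y" by (rule small)
    qed
    then show ?thesis by simp
  qed
  have full: "(\<Sum>r\<in>{l * B..<q * B}. c (r div B)) = real B * (\<Sum>p\<in>{l..<q}. c p)" if "l \<le> q" for l q
    using that
  proof (induction q rule: dec_induct)
    case (step q)
    have "(\<Sum>r\<in>{l * B..<Suc q * B}. c (r div B))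
        = (\<Sum>r\<in>{l * B..<q * B}. c (r div B)) + (\<Sum>r\<in>{q * B..<Suc q * B}. c (r div B))"
      using step by (intro sum.atLeastLessThan_concat[symmetric]) auto
    also have "(\<Sum>r\<in>{q * B..<Suc q * B}. c (r div B)) = (\<Sum>r\<in>{q * B..<Suc q * B}. c q)"
    proof (intro sum.cong refl)
      fix r assume "r \<in> {q * B..<Suc q * B}"
      then have "r div B = q" by (intro div_nat_eqI) (auto simp: mult.commute)
      then show "c (r div B) = c q" by simp
    qed
    finally show ?case using step by (simp add: algebra_simps)
  qed simp
  \<comment> \<open>The complete blocks are those with number in \<open>{l..<q}\<close>.\<close>
  define q where "q = k' div B"
  define l where "l = (k + (B - 1)) div B"
  have qB: "q * B \<le> k'" "k' < q * B + B"
    using assms(1) by (auto simp: q_def) (metis add.commute dividend_less_div_times)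
  have lB: "k \<le> l * B" "l * B \<le> k + (B - 1)"
  proof -
    have "k + (B - 1) < l * B + B" unfolding l_def using assms(1) by (metis add.commute dividend_less_div_times)
    then show "k \<le> l * B" using assms(1) by linarith
    show "l * B \<le> k + (B - 1)" by (simp add: l_def)
  qed
  have qP: "q \<le> P"
    using div_le_mono[OF assms(3), of B] assms(1) by (simp add: q_def)
  show ?thesis
  proof (cases "l \<le> q")
    case True
    then have lq: "l * B \<le> q * B" by simp
    define u where "u = (l * B - k) + (k' - q * B)"
    have u: "u + B * (q - l) = k' - k" "u \<le> 2 * (B - 1)"
      using qB lB lq by (auto simp: u_def diff_mult_distrib2 mult.commute)
    have "\<bar>\<Sum>p\<in>{l..<q}. c p\<bar> \<le> z"
      using blocks[of l q] qP u(1) \<open>0 \<le> z\<close> by (cases "l < q") auto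
    then have "\<bar>real B * (\<Sum>p\<in>{l..<q}. c p)\<bar> \<le> real B * z" by (simp add: abs_mult mult_left_mono)
    moreover have "(\<Sum>r\<in>{k..<k'}. c (r div B)) = (\<Sum>r\<in>{k..<l * B}. c (r div B))
        + real B * (\<Sum>p\<in>{l..<q}. c p) + (\<Sum>r\<in>{q * B..<k'}. c (r div B))"
      using qB lB lq order.trans[OF lq qB(1)] sum.atLeastLessThan_concat[of k "l * B" k' "\<lambda>r. c (r div B)"]
        sum.atLeastLessThan_concat[of "l * B" "q * B" k' "\<lambda>r. c (r div B)"] full[OF True]
      by simp
    moreover have "\<bar>\<Sum>r\<in>{k..<l * B}. c (r div B)\<bar> \<le> real (l * B - k) * y"
      "\<bar>\<Sum>r\<in>{q * B..<k'}. c (r div B)\<bar> \<le> real (k' - q * B) * y"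
      using part[of "l * B" k] part[of k' "q * B"] order.trans[OF lq qB(1)] by auto
    ultimately have "\<bar>\<Sum>r\<in>{k..<k'}. c (r div B)\<bar> \<le> real u * y + real B * z"
      by (simp add: u_def algebra_simps)
    also have "real u * y \<le> real (min (k' - k) (2 * (B - 1))) * y"
      using u y by (intro mult_right_mono) auto
    finally show ?thesis by simp
  next
    case False
    then have "q * B + B \<le> l * B" by (metis Suc_leI mult_Suc add.commute mult_le_mono1 not_le)
    then have "k' - k \<le> 2 * (B - 1)" using qB lB by linarith
    then have "\<bar>\<Sum>r\<in>{k..<k'}. c (r div B)\<bar> \<le> real (min (k' - k) (2 * (B - 1))) * y"
      using part[of k' k] by simp
    then show ?thesis using \<open>0 \<le> z\<close> by (simp add: add_increasing2)
  qed
qed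

text \<open>
  The constant \<open>3/4\<close> is a sum of a contribution \<open>E\<close> of the incomplete blocks and \<open>E / 2\<close> of the
  complete ones, with \<open>E = 2 powr (- m * (1 + \<beta> - 2 * \<alpha>))\<close>. Since \<open>1 + \<beta> - 2 * \<alpha> > 1 / 2\<close>, one has
  \<open>E \<le> 1 / 2\<close> for \<open>m \<ge> 2\<close>; for \<open>m = 1\<close> the incomplete blocks are empty and \<open>E \<le> 1\<close> suffices.
\<close>

lemma mean_numeric_bound:
  fixes \<alpha> \<beta> \<alpha>' \<epsilon> \<theta> :: real and m \<kappa> :: nat
  assumes ab: "\<alpha> < 1/2" "1 - \<alpha> < \<beta>" "\<beta> < 2 * \<alpha>" and "\<alpha> < \<alpha>'"
    and \<theta>: "0 < \<theta>" "\<theta> \<le> 1" and m: "1 \<le> m" and \<kappa>: "1 \<le> \<kappa>" and \<epsilon>: "0 < \<epsilon>" "\<epsilon> < 1/2"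
  defines "B \<equiv> (2::nat) ^ (m - 1)"
  shows "(real (min \<kappa> (2 * (B - 1))) * \<theta> powr (2 * \<alpha>')
      + real B * (\<epsilon> * (real \<kappa> / real B) powr \<beta> * \<theta> powr (2 * \<alpha>'))) / 4 ^ m
    \<le> 3 / 4 * (real \<kappa> powr \<beta> * (\<theta> * (1 / 2 ^ m)) powr (2 * \<alpha>))"
proof -
  define E where "E = 2 powr (- (real m * (1 + \<beta> - 2 * \<alpha>)))"
  define S where "S = real \<kappa> powr \<beta> * (1 / 2 ^ m) powr (2 * \<alpha>)"
  have b: "0 < \<beta>" "\<beta> < 1" and e: "1 / 2 < 1 + \<beta> - 2 * \<alpha>" using ab by linarith+
  have S0: "0 \<le> S" by (simp add: S_def)
  have E0: "0 \<le> E" by (simp add: E_def)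
  have pow: "real \<kappa> powr \<beta> * (2 ^ m) powr (1 - \<beta>) / 4 ^ m = S * E"
  proof -
    have "(2 ^ m :: real) powr (1 - \<beta>) / 4 ^ m = 2 powr (real m * (1 - \<beta>) - 2 * real m)"
    proof -
      have four: "(4::real) ^ m = 2 powr (2 * real m)"
        by (simp add: powr_powr[symmetric] powr_realpow)
      have two: "(2::real) ^ m = 2 powr real m"
        by (simp add: powr_realpow)
      show ?thesis unfolding four two powr_powr by (simp only: powr_diff)
    qed
    moreover have "(1 / 2 ^ m :: real) powr (2 * \<alpha>) * E = 2 powr (real m * (1 - \<beta>) - 2 * real m)"
    proof -
      have "(1 / 2 ^ m :: real) = 2 powr (- real m)" by (simp add: powr_minus divide_inverse powr_realpow)
      then show ?thesis by (simp add: E_def powr_powr algebra_simps flip: powr_add)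
    qed
    ultimately show ?thesis
      unfolding S_def times_divide_eq_right[symmetric] mult.assoc by (simp only:)
  qed
  have partial: "real (min \<kappa> (2 * (B - 1))) / 4 ^ m \<le> S * (if m = 1 then 0 else E)"
  proof (cases "m = 1")
    case True
    then show ?thesis by (simp add: B_def)
  next
    case False
    define u where "u = real (min \<kappa> (2 * (B - 1)))"
    have "2 * B = 2 ^ m" using m by (simp add: B_def flip: power_Suc)
    then have "2 * (B - 1) \<le> 2 ^ m" by linarith
    then have "min \<kappa> (2 * (B - 1)) \<le> 2 ^ m" by linarith
    then have "u \<le> real (2 ^ m)" unfolding u_def by (simp only: of_nat_le_iff)
    then have u: "0 \<le> u" "u \<le> real \<kappa>" "u \<le> 2 ^ m" by (auto simp: u_def)
    have "u = u powr \<beta> * u powr (1 - \<beta>)" using u(1) by (cases "u = 0") (auto simp flip: powr_add)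
    also have "\<dots> \<le> real \<kappa> powr \<beta> * (2 ^ m) powr (1 - \<beta>)"
      using u b by (intro mult_mono powr_mono2) auto
    finally have "u / 4 ^ m \<le> real \<kappa> powr \<beta> * (2 ^ m) powr (1 - \<beta>) / 4 ^ m"
      by (rule divide_right_mono) simp
    then show ?thesis using False by (simp add: pow u_def)
  qed
  have full: "real B * (\<epsilon> * (real \<kappa> / real B) powr \<beta>) / 4 ^ m \<le> S * (E / 2)"
  proof -
    have B: "0 < real B" "real B \<le> 2 ^ m" by (auto simp: B_def)
    have "real B * (\<epsilon> * (real \<kappa> / real B) powr \<beta>) = \<epsilon> * (real \<kappa> powr \<beta> * real B powr (1 - \<beta>))"
      using B by (simp add: powr_divide powr_diff)
    also have "\<dots> \<le> 1 / 2 * (real \<kappa> powr \<beta> * (2 ^ m) powr (1 - \<beta>))"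
      using B b \<epsilon> by (intro mult_mono powr_mono2) auto
    finally have "real B * (\<epsilon> * (real \<kappa> / real B) powr \<beta>) / 4 ^ m
        \<le> 1 / 2 * (real \<kappa> powr \<beta> * (2 ^ m) powr (1 - \<beta>)) / 4 ^ m"
      by (rule divide_right_mono) simp
    also have "\<dots> = S * (E / 2)" using pow by simp
    finally show ?thesis .
  qed
  have factor: "(if m = 1 then 0 else E) + E / 2 \<le> 3 / 4"
  proof (cases "m = 1")
    case True
    have "E \<le> 2 powr 0" unfolding E_def using e by (intro powr_mono) auto
    then show ?thesis using True by simp
  next
    case False
    then have "2 \<le> real m" using m by simp
    then have "2 * (1/2) \<le> real m * (1 + \<beta> - 2 * \<alpha>)" using e by (intro mult_mono) auto
    then have "E \<le> 2 powr (-1)" unfolding E_def by (intro powr_mono) auto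
    then show ?thesis by (simp add: powr_minus)
  qed
  have "(real (min \<kappa> (2 * (B - 1))) * \<theta> powr (2 * \<alpha>')
      + real B * (\<epsilon> * (real \<kappa> / real B) powr \<beta> * \<theta> powr (2 * \<alpha>'))) / 4 ^ m
    = \<theta> powr (2 * \<alpha>') * (real (min \<kappa> (2 * (B - 1))) / 4 ^ m
      + real B * (\<epsilon> * (real \<kappa> / real B) powr \<beta>) / 4 ^ m)"
    by (simp add: field_simps del: of_nat_min)
  also have "\<dots> \<le> \<theta> powr (2 * \<alpha>) * (S * (if m = 1 then 0 else E) + S * (E / 2))"
  proof (rule mult_mono)
    show "\<theta> powr (2 * \<alpha>') \<le> \<theta> powr (2 * \<alpha>)"
      using \<theta> \<open>\<alpha> < \<alpha>'\<close> by (intro powr_mono') simp_all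
    show "real (min \<kappa> (2 * (B - 1))) / 4 ^ m + real B * (\<epsilon> * (real \<kappa> / real B) powr \<beta>) / 4 ^ m
        \<le> S * (if m = 1 then 0 else E) + S * (E / 2)"
      using partial full by (rule add_mono)
  qed (use \<epsilon> in auto)
  also have "\<dots> = \<theta> powr (2 * \<alpha>) * S * ((if m = 1 then 0 else E) + E / 2)"
    by (simp add: algebra_simps)
  also have "\<dots> \<le> \<theta> powr (2 * \<alpha>) * S * (3 / 4)"
    using factor S0 by (intro mult_left_mono) auto
  also have "\<dots> = 3 / 4 * (real \<kappa> powr \<beta> * (\<theta> * (1 / 2 ^ m)) powr (2 * \<alpha>))"
    unfolding S_def powr_mult by (simp only: mult_ac)
  finally show ?thesis .
qed

text \<open>
  Each of the \<open>\<kappa>\<close> factors in \<open>chaos_exp_bound\<close> is \<open>1 + O(1 / \<kappa>)\<close>, so their product is bounded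
  independently of \<open>\<kappa>\<close>.
\<close>

lemma noise_numeric_bound:
  fixes a b :: real and \<kappa> :: nat
  assumes \<kappa>: "1 \<le> \<kappa>" and a: "a\<^sup>2 \<le> 1 / (4 * real \<kappa>)" and b: "0 \<le> b" "b \<le> 1 / (8 * real \<kappa>)"
  shows "(1 / sqrt (1 - a\<^sup>2) * exp (b / (1 - \<bar>a\<bar>))) ^ \<kappa> \<le> exp (1 / 2)"
proof -
  have "1 / (4 * real \<kappa>) \<le> 1 / 4" using \<kappa> by (simp add: field_simps)
  then have a4: "a\<^sup>2 \<le> (1 / 2)\<^sup>2" using a by (simp add: power2_eq_square)
  then have a2: "\<bar>a\<bar> \<le> 1 / 2" using abs_le_square_iff[of a "1 / 2"] by simp
  have "a\<^sup>2 * a\<^sup>2 \<le> a\<^sup>2 * (1 / 2)" using a4 by (intro mult_left_mono) (auto simp: power2_eq_square)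
  then have "- 2 * a\<^sup>2 \<le> - a\<^sup>2 - 2 * (a\<^sup>2)\<^sup>2" by (simp add: power2_eq_square)
  also have "\<dots> \<le> ln (1 - a\<^sup>2)"
    using a4 by (intro ln_one_minus_pos_lower_bound) (auto simp: power2_eq_square)
  finally have ln: "- a\<^sup>2 \<le> ln (1 - a\<^sup>2) / 2" by simp
  have "a\<^sup>2 < 1" using a4 by (simp add: power2_eq_square)
  then have "exp (ln (1 - a\<^sup>2) / 2) = sqrt (1 - a\<^sup>2)"
    using exp_ln[of "sqrt (1 - a\<^sup>2)"] by (simp only: ln_sqrt real_sqrt_gt_0_iff diff_gt_0_iff_gt)
  then have "1 / sqrt (1 - a\<^sup>2) = exp (- (ln (1 - a\<^sup>2) / 2))"
    by (simp only: exp_minus inverse_eq_divide)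
  also have "\<dots> \<le> exp (1 / (4 * real \<kappa>))" using ln a by simp
  finally have 1: "1 / sqrt (1 - a\<^sup>2) \<le> exp (1 / (4 * real \<kappa>))" .
  have "b / (1 - \<bar>a\<bar>) \<le> 1 / (8 * real \<kappa>) / (1 / 2)"
    using a2 b by (intro frac_le) simp_all
  also have "\<dots> = 1 / (4 * real \<kappa>)" by simp
  finally have 2: "exp (b / (1 - \<bar>a\<bar>)) \<le> exp (1 / (4 * real \<kappa>))" by (simp only: exp_le_cancel_iff)
  have "(1 / sqrt (1 - a\<^sup>2) * exp (b / (1 - \<bar>a\<bar>))) ^ \<kappa> \<le> (exp (1 / (4 * real \<kappa>)) * exp (1 / (4 * real \<kappa>))) ^ \<kappa>"
    using 1 2 \<open>a\<^sup>2 < 1\<close> by (intro power_mono mult_mono) auto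
  also have "\<dots> = exp (1 / 2)"
    using \<kappa> by (simp add: mult_exp_exp flip: exp_of_nat_mult)
  finally show ?thesis .
qed

section \<open>The law of the bridges\<close>

abbreviation coeff_at :: "(nat \<Rightarrow> nat \<Rightarrow> nat \<Rightarrow> 'a \<Rightarrow> real) \<Rightarrow> nat \<times> nat \<times> nat \<Rightarrow> 'a \<Rightarrow> real"
  where "coeff_at W \<equiv> (\<lambda>(i, n, k). W i n k)"

lemma fine_index_coeff: "i \<in> {1..d} \<Longrightarrow> Pair i ` fine_index n m \<subseteq> coeff_index d"
  by (auto simp: fine_index_def coeff_index_def)

context levy_ciesielski
begin

lemma measurable_coeff: "e \<in> coeff_index d \<Longrightarrow> coeff_at W e \<in> borel_measurable M"
  using indep_coeffs by (auto simp: indep_vars_def2)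

lemma measurable_W: "(i, n, k) \<in> coeff_index d \<Longrightarrow> W i n k \<in> borel_measurable M"
  using measurable_coeff[of "(i, n, k)"] by simp

lemma nn_integral_exp_coeff:
  assumes "(i, n, k) \<in> coeff_index d"
  shows "(\<integral>\<^sup>+\<omega>. exp (t * W i n k \<omega>) \<partial>M) = ennreal (exp (t\<^sup>2 / 2))"
proof -
  have "(\<integral>\<^sup>+\<omega>. exp (t * W i n k \<omega>) \<partial>M) = (\<integral>\<^sup>+z. exp (t * z) \<partial>density lborel std_normal_density)"
    unfolding distributed_distr_eq_density[OF normal_coeffs[OF assms], symmetric]
    by (subst nn_integral_distr) (auto simp: measurable_W[OF assms])
  then show ?thesis by (simp add: nn_integral_gauss_exp)
qed

text \<open>
  A linear functional of the bridge is a linear combination of independent standard normal variables,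
  whose variance is bounded by \<open>bridge_linear_on\<close>.
\<close>

lemma bridge_subgaussian:
  assumes i: "i \<in> {1..d}" and R: "finite R" "inj_on f R" "f ` R \<subseteq> {..<2 ^ (n + m)}"
  shows "(\<integral>\<^sup>+\<omega>. exp (\<Sum>r\<in>R. w r * bridge n m (\<lambda>(h, l). W i h l \<omega>) (f r)) \<partial>M)
    \<le> exp (\<Delta> (n + m) / 2 * (\<Sum>r\<in>R. (w r)\<^sup>2))"
proof -
  obtain a where a: "\<And>x. (\<Sum>r\<in>R. w r * bridge n m x (f r)) = (\<Sum>e\<in>fine_index n m. a e * x e)"
    and a_le: "(\<Sum>e\<in>fine_index n m. (a e)\<^sup>2) \<le> \<Delta> (n + m) * (\<Sum>r\<in>R. (w r)\<^sup>2)"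
    using bridge_linear_on[OF R, of w] by blast
  define K where "K = Pair i ` fine_index n m"
  have K: "K \<subseteq> coeff_index d" "finite K"
    unfolding K_def using fine_index_coeff[OF i] by auto
  have K_sum: "(\<Sum>e\<in>fine_index n m. h (i, e)) = (\<Sum>e\<in>K. h e)" for h :: "_ \<Rightarrow> real"
    unfolding K_def by (subst sum.reindex) (auto simp: inj_on_def)
  have ind: "indep_vars (\<lambda>_. borel) (\<lambda>e \<omega>. ennreal (exp (a (snd e) * coeff_at W e \<omega>))) K"
    by (rule indep_vars_compose2[OF indep_vars_subset[OF indep_coeffs K(1)],
          where Y = "\<lambda>e x. ennreal (exp (a (snd e) * x))"]) simp
  have lin: "(\<Sum>r\<in>R. w r * bridge n m (\<lambda>(h, l). W i h l \<omega>) (f r)) = (\<Sum>e\<in>K. a (snd e) * coeff_at W e \<omega>)" for \<omega>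
    using K_sum[of "\<lambda>e. a (snd e) * coeff_at W e \<omega>"] by (simp add: a case_prod_unfold)
  have "(\<integral>\<^sup>+\<omega>. exp (\<Sum>r\<in>R. w r * bridge n m (\<lambda>(h, l). W i h l \<omega>) (f r)) \<partial>M)
      = (\<integral>\<^sup>+\<omega>. (\<Prod>e\<in>K. ennreal (exp (a (snd e) * coeff_at W e \<omega>))) \<partial>M)"
    by (simp only: lin exp_sum[OF K(2)] prod_ennreal[OF exp_ge_zero])
  also have "\<dots> = (\<Prod>e\<in>K. ennreal (exp ((a (snd e))\<^sup>2 / 2)))"
    unfolding indep_vars_nn_integral[OF K(2) ind, simplified]
  proof (intro prod.cong refl)
    fix e assume "e \<in> K"
    then show "(\<integral>\<^sup>+\<omega>. exp (a (snd e) * coeff_at W e \<omega>) \<partial>M) = ennreal (exp ((a (snd e))\<^sup>2 / 2))"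
      using K(1) nn_integral_exp_coeff[of "fst e" "fst (snd e)" "snd (snd e)" "a (snd e)"]
      by (auto simp: case_prod_unfold)
  qed
  also have "\<dots> = ennreal (exp ((\<Sum>e\<in>fine_index n m. (a e)\<^sup>2) / 2))"
    using K_sum[of "\<lambda>e. (a (snd e))\<^sup>2 / 2"] K(2) by (simp add: exp_sum prod_ennreal sum_divide_distrib)
  also have "\<dots> \<le> exp (\<Delta> (n + m) / 2 * (\<Sum>r\<in>R. (w r)\<^sup>2))"
    using a_le by (intro ennreal_leI) simp
  finally show ?thesis .
qed

text \<open>
  The bridges of different coordinates are functions of disjoint families of coefficients, hence
  independent, and \<open>chaos_exp_bound\<close> applies to their joint law.
\<close>

lemma bridge_chaos_exp_bound:
  fixes \<mu> \<nu> :: "nat \<Rightarrow> real"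
  assumes ij: "i \<in> {1..d}" "j \<in> {1..d}" "i \<noteq> j" and R: "finite R"
    and f: "inj_on f R" "f ` R \<subseteq> {..<2 ^ (n + m)}" and g: "inj_on g R" "g ` R \<subseteq> {..<2 ^ (n + m)}"
    and small: "\<bar>\<kappa> * \<Delta> (n + m)\<bar> < 1"
    and \<mu>: "\<And>r. r \<in> R \<Longrightarrow> \<bar>\<mu> r\<bar> \<le> \<rho>" and \<nu>: "\<And>r. r \<in> R \<Longrightarrow> \<bar>\<nu> r\<bar> \<le> \<rho>"
  shows "(\<integral>\<^sup>+\<omega>. exp (\<kappa> * (\<Sum>r\<in>R. (\<mu> r + bridge n m (\<lambda>(h, l). W i h l \<omega>) (f r))
        * (\<nu> r + bridge n m (\<lambda>(h, l). W j h l \<omega>) (g r)))) \<partial>M)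
    \<le> ennreal (exp (\<kappa> * (\<Sum>r\<in>R. \<mu> r * \<nu> r))
        * (1 / sqrt (1 - (\<kappa> * \<Delta> (n + m))\<^sup>2)
          * exp (\<kappa>\<^sup>2 * \<Delta> (n + m) * \<rho>\<^sup>2 / (1 - \<bar>\<kappa> * \<Delta> (n + m)\<bar>))) ^ card R)"
proof -
  let ?N = "PiM R (\<lambda>_. borel :: real measure)"
  define K where "K i = Pair i ` fine_index n m" for i :: nat
  define vec where "vec i f u = (\<lambda>r\<in>R. bridge n m (\<lambda>e. u (i, e)) (f r))" for i f and u :: "nat \<times> nat \<times> nat \<Rightarrow> real"
  define X where "X = (\<lambda>\<omega>. \<lambda>r\<in>R. bridge n m (\<lambda>(h, l). W i h l \<omega>) (f r))"
  define Y where "Y = (\<lambda>\<omega>. \<lambda>r\<in>R. bridge n m (\<lambda>(h, l). W j h l \<omega>) (g r))"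
  have vec_meas: "vec i f \<in> measurable (PiM (K i) (\<lambda>_. borel)) ?N" if "f ` R \<subseteq> {..<2 ^ (n + m)}" for i f
    unfolding vec_def
  proof (rule measurable_restrict)
    fix r assume "r \<in> R"
    then show "(\<lambda>u. bridge n m (\<lambda>e. u (i, e)) (f r)) \<in> borel_measurable (PiM (K i) (\<lambda>_. borel))"
      using that by (intro measurable_bridge measurable_component_singleton) (auto simp: K_def)
  qed
  have vec_eq: "vec i f (\<lambda>e\<in>K i. coeff_at W e \<omega>) = (\<lambda>r\<in>R. bridge n m (\<lambda>(h, l). W i h l \<omega>) (f r))"
    if "f ` R \<subseteq> {..<2 ^ (n + m)}" for i f \<omega>
    unfolding vec_def using that by (intro restrict_ext bridge_cong) (auto simp: K_def)
  have "indep_var (PiM (K i) (\<lambda>_. borel)) (\<lambda>\<omega>. \<lambda>e\<in>K i. coeff_at W e \<omega>)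
      (PiM (K j) (\<lambda>_. borel)) (\<lambda>\<omega>. \<lambda>e\<in>K j. coeff_at W e \<omega>)"
    using ij fine_index_coeff by (intro indep_var_restrict[OF indep_coeffs]) (auto simp: K_def)
  from indep_var_compose[OF this vec_meas[OF f(2)] vec_meas[OF g(2)]]
  have ind: "indep_var ?N X ?N Y"
    by (simp add: comp_def vec_eq[OF f(2)] vec_eq[OF g(2)] X_def Y_def)
  have rv[measurable]: "X \<in> measurable M ?N" "Y \<in> measurable M ?N"
    using indep_var_rv1[OF ind] indep_var_rv2[OF ind] .
  interpret X: prob_space "distr M ?N X" by (rule prob_space_distr) simp
  interpret Y: prob_space "distr M ?N Y" by (rule prob_space_distr) simp
  interpret XY: pair_sigma_finite "distr M ?N X" "distr M ?N Y" ..
  have law: "distr M (?N \<Otimes>\<^sub>M ?N) (\<lambda>\<omega>. (X \<omega>, Y \<omega>)) = distr M ?N X \<Otimes>\<^sub>M distr M ?N Y"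
    using indep_var_distribution_eq[THEN iffD1, OF ind] by simp
  have [measurable]: "(\<lambda>x. x r) \<in> borel_measurable ?N" if "r \<in> R" for r
    using that by (rule measurable_component_singleton)
  let ?F = "\<lambda>(x, y). ennreal (exp (\<kappa> * (\<Sum>r\<in>R. (\<mu> r + x r) * (\<nu> r + y r))))"
  have F: "?F \<in> borel_measurable (?N \<Otimes>\<^sub>M ?N)" by measurable
  have "(\<integral>\<^sup>+\<omega>. exp (\<kappa> * (\<Sum>r\<in>R. (\<mu> r + bridge n m (\<lambda>(h, l). W i h l \<omega>) (f r))
        * (\<nu> r + bridge n m (\<lambda>(h, l). W j h l \<omega>) (g r)))) \<partial>M)
      = (\<integral>\<^sup>+\<omega>. ?F (X \<omega>, Y \<omega>) \<partial>M)"
    by (simp add: X_def Y_def)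
  also have "\<dots> = (\<integral>\<^sup>+p. ?F p \<partial>(distr M ?N X \<Otimes>\<^sub>M distr M ?N Y))"
    unfolding law[symmetric] by (subst nn_integral_distr) (auto intro: F)
  also have "\<dots> = (\<integral>\<^sup>+y. \<integral>\<^sup>+x. ?F (x, y) \<partial>distr M ?N X \<partial>distr M ?N Y)"
    by (rule XY.nn_integral_snd[symmetric]) (use F in simp)
  also have "\<dots> \<le> ennreal (exp (\<kappa> * (\<Sum>r\<in>R. \<mu> r * \<nu> r))
        * (1 / sqrt (1 - (\<kappa> * \<Delta> (n + m))\<^sup>2)
          * exp (\<kappa>\<^sup>2 * \<Delta> (n + m) * \<rho>\<^sup>2 / (1 - \<bar>\<kappa> * \<Delta> (n + m)\<bar>))) ^ card R)"
    unfolding split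
  proof (rule chaos_exp_bound[OF R _ _ _ _ _ _ _ small \<mu> \<nu>])
    show "(\<integral>\<^sup>+x. exp (\<Sum>r\<in>R. w r * x r) \<partial>distr M ?N X) \<le> exp (\<Delta> (n + m) / 2 * (\<Sum>r\<in>R. (w r)\<^sup>2))" for w
      using bridge_subgaussian[OF ij(1) R f, of w] by (subst nn_integral_distr[OF rv(1)]) (measurable, simp add: X_def)
    show "(\<integral>\<^sup>+y. exp (\<Sum>r\<in>R. w r * y r) \<partial>distr M ?N Y) \<le> exp (\<Delta> (n + m) / 2 * (\<Sum>r\<in>R. (w r)\<^sup>2))" for w
      using bridge_subgaussian[OF ij(2) R g, of w] by (subst nn_integral_distr[OF rv(2)]) (measurable, simp add: Y_def)
  qed (auto simp: mesh_def X.sigma_finite_measure_axioms Y.sigma_finite_measure_axioms)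
  finally show ?thesis .
qed

end

section \<open>The tail of the area increment\<close>

text \<open>
  Markov's inequality for \<open>exp (t * S)\<close> and \<open>exp (- t * S)\<close>, where \<open>a\<close> and \<open>b\<close> are the increments of a
  fixed skeleton. Of the threshold \<open>T\<close> the mean of \<open>S\<close> uses up at most three quarters; the remaining
  quarter gives \<open>exp (- t * T / 4) = exp (- X / 8)\<close>, whence the restriction \<open>\<gamma> \<le> 1 / 4\<close>.
\<close>

lemma (in levy_ciesielski) frozen_area_tail:
  fixes a b :: "nat \<Rightarrow> real" and n m k k' :: nat and \<alpha> \<beta> \<alpha>' \<epsilon> \<gamma> :: real
  assumes ij: "i \<in> {1..d}" "j \<in> {1..d}" "i \<noteq> j"
    and m: "1 \<le> m" and k: "k < k'" "k' \<le> 2 ^ (n + m - 1)"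
    and ab: "\<alpha> < 1/2" "1 - \<alpha> < \<beta>" "\<beta> < 2 * \<alpha>" and \<alpha>': "\<alpha> < \<alpha>'" "\<alpha>' < 1/2"
    and \<epsilon>: "0 < \<epsilon>" "\<epsilon> < 1/2" and \<gamma>: "0 < \<gamma>" "\<gamma> \<le> 1/4"
    and a: "\<And>p. p < 2 ^ n \<Longrightarrow> \<bar>a p\<bar> \<le> \<Delta> n powr \<alpha>'"
    and b: "\<And>p. p < 2 ^ n \<Longrightarrow> \<bar>b p\<bar> \<le> \<Delta> n powr \<alpha>'"
    and sums: "\<And>l q. l < q \<Longrightarrow> q \<le> 2 ^ n \<Longrightarrow>
      \<bar>\<Sum>p\<in>{l..<q}. a p * b p\<bar> \<le> \<epsilon> * real (q - l) powr \<beta> * \<Delta> n powr (2 * \<alpha>')"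
  shows "prob {\<omega> \<in> space M. real (k' - k) powr \<beta> * \<Delta> (n + m) powr (2 * \<alpha>) < \<bar>\<Sum>r\<in>{k..<k'}.
      (a (r div 2 ^ (m - 1)) / 2 ^ m + bridge n m (\<lambda>(h, l). W i h l \<omega>) (2 * r))
      * (b (r div 2 ^ (m - 1)) / 2 ^ m + bridge n m (\<lambda>(h, l). W j h l \<omega>) (Suc (2 * r)))\<bar>}
    \<le> 8 * exp (- (1/2) * \<gamma> * real (k' - k) powr (\<beta> - 1/2)
        * \<Delta> n powr (2 * (\<alpha> - \<alpha>')) * \<Delta> m powr (2 * \<alpha> - 1))"
proof -
  define \<theta> where "\<theta> = \<Delta> n"
  define \<sigma> where "\<sigma> = \<Delta> (n + m)"
  define \<kappa> where "\<kappa> = k' - k"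
  define B :: nat where "B = 2 ^ (m - 1)"
  define T where "T = real \<kappa> powr \<beta> * \<sigma> powr (2 * \<alpha>)"
  define X where "X = real \<kappa> powr (\<beta> - 1/2) * \<theta> powr (2 * (\<alpha> - \<alpha>')) * \<Delta> m powr (2 * \<alpha> - 1)"
  define \<eta> where "\<eta> = \<theta> powr (1 - 2 * \<alpha>')"
  \<comment> \<open>The factor \<open>\<eta>\<close> compensates the size of the means: with it, their contribution to the
    exponential moment stays bounded for large \<open>n\<close>, while \<open>t * T\<close> has exactly the power
    \<open>2 * (\<alpha> - \<alpha>')\<close> of \<open>\<theta>\<close> that the claim requires.\<close>
  define t where "t = \<eta> / (2 * \<sigma> * sqrt (real \<kappa>))"
  define \<mu> where "\<mu> r = a (r div B) / 2 ^ m" for r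
  define \<nu> where "\<nu> r = b (r div B) / 2 ^ m" for r
  define S where "S \<omega> = (\<Sum>r\<in>{k..<k'}. (\<mu> r + bridge n m (\<lambda>(h, l). W i h l \<omega>) (2 * r))
      * (\<nu> r + bridge n m (\<lambda>(h, l). W j h l \<omega>) (Suc (2 * r))))" for \<omega>
  have \<theta>: "0 < \<theta>" "\<theta> \<le> 1" by (auto simp: \<theta>_def mesh_def)
  have \<sigma>: "0 < \<sigma>" and \<sigma>_eq: "\<sigma> = \<theta> * (1 / 2 ^ m)" by (auto simp: \<sigma>_def \<theta>_def mesh_def power_add)
  have \<kappa>: "1 \<le> \<kappa>" using k by (simp add: \<kappa>_def)
  have \<eta>: "0 < \<eta>" "\<eta> \<le> 1"
    using \<theta> \<alpha>' powr_mono'[of 0 "1 - 2 * \<alpha>'" \<theta>] by (auto simp: \<eta>_def)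
  have t: "0 < t" using \<eta> \<sigma> \<kappa> by (simp add: t_def)
  have pow: "(2::nat) ^ (n + m - 1) = B * 2 ^ n" using m by (simp add: B_def flip: power_add)
  have block: "r div B < 2 ^ n" if "r \<in> {k..<k'}" for r
    using that k pow by (intro less_mult_imp_div_less) (auto simp: mult.commute)

  have mean: "\<bar>\<Sum>r\<in>{k..<k'}. \<mu> r * \<nu> r\<bar> \<le> 3 / 4 * T"
  proof -
    define z where "z = \<epsilon> * (real \<kappa> / real B) powr \<beta> * \<theta> powr (2 * \<alpha>')"
    have "\<bar>\<Sum>r\<in>{k..<k'}. a (r div B) * b (r div B)\<bar>
        \<le> real (min \<kappa> (2 * (B - 1))) * \<theta> powr (2 * \<alpha>') + real B * z"
      unfolding \<kappa>_def
    proof (rule abs_sum_div_le[of B k k' "2 ^ n" "\<lambda>p. a p * b p"])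
      show "\<bar>a p * b p\<bar> \<le> \<theta> powr (2 * \<alpha>')" if "p < 2 ^ n" for p
      proof -
        have "\<bar>a p * b p\<bar> \<le> \<theta> powr \<alpha>' * \<theta> powr \<alpha>'"
          unfolding abs_mult using a[OF that] b[OF that] by (intro mult_mono) (auto simp: \<theta>_def)
        then show ?thesis by (simp flip: powr_add)
      qed
      show "\<bar>\<Sum>p\<in>{l..<q}. a p * b p\<bar> \<le> z" if "l < q" "q \<le> 2 ^ n" "B * (q - l) \<le> k' - k" for l q
      proof -
        have "real (B * (q - l)) \<le> real \<kappa>" using that(3) unfolding \<kappa>_def by (simp only: of_nat_le_iff)
        then have "real (q - l) \<le> real \<kappa> / real B" by (simp add: B_def field_simps)
        then have "\<epsilon> * real (q - l) powr \<beta> * \<theta> powr (2 * \<alpha>') \<le> z"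
          unfolding z_def using ab \<epsilon> by (intro mult_right_mono mult_left_mono powr_mono2) auto
        then show ?thesis using sums[OF that(1,2)] by (simp add: \<theta>_def)
      qed
    qed (use k \<epsilon> pow in \<open>auto simp: B_def z_def\<close>)
    then have "\<bar>\<Sum>r\<in>{k..<k'}. a (r div B) * b (r div B)\<bar> / 4 ^ m
        \<le> (real (min \<kappa> (2 * (B - 1))) * \<theta> powr (2 * \<alpha>') + real B * z) / 4 ^ m"
      by (rule divide_right_mono) simp
    also have "\<dots> \<le> 3 / 4 * T"
      unfolding z_def T_def \<sigma>_eq B_def by (rule mean_numeric_bound[OF ab \<alpha>'(1) \<theta> m \<kappa> \<epsilon>])
    also have "\<bar>\<Sum>r\<in>{k..<k'}. a (r div B) * b (r div B)\<bar> / 4 ^ m = \<bar>\<Sum>r\<in>{k..<k'}. \<mu> r * \<nu> r\<bar>"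
      by (simp add: \<mu>_def \<nu>_def flip: sum_divide_distrib power_mult_distrib)
    finally show ?thesis .
  qed

  have exponent: "t * T = X / 2"
  proof -
    have 1: "\<sigma> powr (2 * \<alpha>) / \<sigma> = \<theta> powr (2 * \<alpha> - 1) * \<Delta> m powr (2 * \<alpha> - 1)"
      using \<sigma> \<theta> unfolding powr_mult[symmetric] by (simp add: \<sigma>_eq mesh_def powr_diff)
    have 2: "\<eta> * \<theta> powr (2 * \<alpha> - 1) = \<theta> powr (2 * (\<alpha> - \<alpha>'))"
      by (simp add: \<eta>_def algebra_simps flip: powr_add)
    have 3: "real \<kappa> powr \<beta> / sqrt (real \<kappa>) = real \<kappa> powr (\<beta> - 1/2)"
      using \<kappa> by (simp add: powr_diff powr_half_sqrt)
    have "t * T = (real \<kappa> powr \<beta> / sqrt (real \<kappa>)) * (\<eta> * (\<sigma> powr (2 * \<alpha>) / \<sigma>)) / 2"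
      by (simp add: t_def T_def mult_ac)
    then show ?thesis unfolding 1 3 X_def 2[symmetric] by (simp add: mult_ac)
  qed

  have bridge_meas: "(\<lambda>\<omega>. bridge n m (\<lambda>(h, l). W i h l \<omega>) s) \<in> borel_measurable M"
    if "i \<in> {1..d}" "s < 2 ^ (n + m)" for i s
    using fine_index_coeff[OF that(1), of n m]
    by (intro measurable_bridge that) (auto simp: case_prod_unfold intro!: measurable_W)
  have idx: "2 * r < 2 ^ (n + m)" "Suc (2 * r) < 2 ^ (n + m)" if "r \<in> {k..<k'}" for r
  proof -
    have "(2::nat) ^ (n + m) = 2 * 2 ^ (n + m - 1)" using m by (simp flip: power_Suc)
    then show "2 * r < 2 ^ (n + m)" "Suc (2 * r) < 2 ^ (n + m)" using that k by auto
  qed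
  have S_meas [measurable]: "S \<in> borel_measurable M"
    unfolding S_def using ij idx
    by (intro borel_measurable_sum borel_measurable_times borel_measurable_add bridge_meas) auto

  \<comment> \<open>Of the exponent, \<open>3 / 8 * X = t * (3 / 4 * T)\<close> is due to the mean and \<open>1 / 2\<close> to the noise.\<close>
  have mgf: "(\<integral>\<^sup>+\<omega>. exp (u * t * S \<omega>) \<partial>M) \<le> ennreal (exp (3 / 8 * X + 1 / 2))" if "\<bar>u\<bar> = 1" for u
  proof -
    define \<rho> where "\<rho> = \<theta> powr \<alpha>' / 2 ^ m"
    have u2: "u\<^sup>2 = 1" using that by (metis one_power2 power2_abs)
    have a2: "(u * t * \<sigma>)\<^sup>2 = \<eta>\<^sup>2 / (4 * real \<kappa>)"
      using \<sigma> by (simp add: t_def power_mult_distrib power_divide u2)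
    have "\<eta>\<^sup>2 \<le> 1" using \<eta> by (simp add: power_le_one)
    then have a_le: "(u * t * \<sigma>)\<^sup>2 \<le> 1 / (4 * real \<kappa>)" unfolding a2 by (intro divide_right_mono) auto
    also have "\<dots> < 1" using \<kappa> by simp
    finally have small: "\<bar>u * t * \<sigma>\<bar> < 1" by (simp add: abs_square_less_1)
    have "\<rho>\<^sup>2 / \<sigma> = \<theta> powr (2 * \<alpha>') / \<theta> * (1 / 2 ^ m)"
    proof -
      have "(\<theta> powr \<alpha>')\<^sup>2 = \<theta> powr (2 * \<alpha>')" by (simp add: power2_eq_square flip: powr_add)
      then have "\<rho>\<^sup>2 = \<theta> powr (2 * \<alpha>') / (2 ^ m * 2 ^ m)"
        by (simp add: \<rho>_def power_divide power2_eq_square)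
      then show ?thesis by (simp add: \<sigma>_eq)
    qed
    moreover have "(u * t)\<^sup>2 * \<sigma> * \<rho>\<^sup>2 = (u * t * \<sigma>)\<^sup>2 * (\<rho>\<^sup>2 / \<sigma>)"
      using \<sigma> by (simp add: power_mult_distrib power2_eq_square)
    ultimately have "(u * t)\<^sup>2 * \<sigma> * \<rho>\<^sup>2
        = \<eta> * (\<eta> * (\<theta> powr (2 * \<alpha>') / \<theta>)) * (1 / 2 ^ m) / (4 * real \<kappa>)"
      unfolding a2 by (simp add: power2_eq_square mult_ac)
    also have "\<eta> * (\<theta> powr (2 * \<alpha>') / \<theta>) = 1"
      using \<theta> by (simp add: \<eta>_def powr_diff)
    also have "\<eta> * 1 * (1 / 2 ^ m) / (4 * real \<kappa>) \<le> 1 / 2 / (4 * real \<kappa>)"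
    proof (rule divide_right_mono)
      have "(2::real) ^ 1 \<le> 2 ^ m" using m by (intro power_increasing) auto
      then have "(1::real) / 2 ^ m \<le> 1 / 2" by (intro divide_left_mono) auto
      then have "\<eta> * (1 / 2 ^ m) \<le> 1 * (1 / 2)" using \<eta> by (intro mult_mono) auto
      then show "\<eta> * 1 * (1 / 2 ^ m) \<le> 1 / 2" by simp
    qed simp
    finally have b_le: "(u * t)\<^sup>2 * \<sigma> * \<rho>\<^sup>2 \<le> 1 / (8 * real \<kappa>)" by simp
    have \<mu>\<nu>: "\<bar>\<mu> r\<bar> \<le> \<rho>" "\<bar>\<nu> r\<bar> \<le> \<rho>" if "r \<in> {k..<k'}" for r
      using a[OF block[OF that]] b[OF block[OF that]]
      by (auto simp: \<mu>_def \<nu>_def \<rho>_def \<theta>_def divide_right_mono)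
    have "(\<integral>\<^sup>+\<omega>. exp (u * t * S \<omega>) \<partial>M) \<le> ennreal (exp (u * t * (\<Sum>r\<in>{k..<k'}. \<mu> r * \<nu> r))
        * (1 / sqrt (1 - (u * t * \<sigma>)\<^sup>2)
          * exp ((u * t)\<^sup>2 * \<sigma> * \<rho>\<^sup>2 / (1 - \<bar>u * t * \<sigma>\<bar>))) ^ card {k..<k'})"
      unfolding S_def \<sigma>_def using idx \<mu>\<nu> small
      by (intro bridge_chaos_exp_bound ij) (auto simp: inj_on_def \<sigma>_def)
    also have "\<dots> \<le> ennreal (exp (3 / 8 * X) * exp (1 / 2))"
    proof (intro ennreal_leI mult_mono)
      have "u * t * (\<Sum>r\<in>{k..<k'}. \<mu> r * \<nu> r) \<le> \<bar>u * t * (\<Sum>r\<in>{k..<k'}. \<mu> r * \<nu> r)\<bar>" by simp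
      also have "\<dots> = t * \<bar>\<Sum>r\<in>{k..<k'}. \<mu> r * \<nu> r\<bar>" using that t by (simp add: abs_mult)
      also have "\<dots> \<le> t * (3 / 4 * T)" using mean t by (intro mult_left_mono) auto
      also have "\<dots> = 3 / 8 * X" using exponent by (simp add: mult.commute)
      finally show "exp (u * t * (\<Sum>r\<in>{k..<k'}. \<mu> r * \<nu> r)) \<le> exp (3 / 8 * X)" by simp
      show "(1 / sqrt (1 - (u * t * \<sigma>)\<^sup>2)
          * exp ((u * t)\<^sup>2 * \<sigma> * \<rho>\<^sup>2 / (1 - \<bar>u * t * \<sigma>\<bar>))) ^ card {k..<k'} \<le> exp (1 / 2)"
        using noise_numeric_bound[OF \<kappa> a_le _ b_le] \<sigma> by (simp add: \<kappa>_def)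
      have "(u * t * \<sigma>)\<^sup>2 < 1" using small by (simp add: abs_square_less_1)
      then show "0 \<le> (1 / sqrt (1 - (u * t * \<sigma>)\<^sup>2)
          * exp ((u * t)\<^sup>2 * \<sigma> * \<rho>\<^sup>2 / (1 - \<bar>u * t * \<sigma>\<bar>))) ^ card {k..<k'}" by simp
    qed auto
    finally show ?thesis by (simp add: exp_add)
  qed

  have "emeasure M {\<omega> \<in> space M. T < \<bar>S \<omega>\<bar>} = (\<integral>\<^sup>+\<omega>. indicator {\<omega> \<in> space M. T < \<bar>S \<omega>\<bar>} \<omega> \<partial>M)"
    by (intro nn_integral_indicator[symmetric]) measurable
  also have "\<dots> \<le> (\<integral>\<^sup>+\<omega>. ennreal (exp (- (t * T))) * (ennreal (exp (1 * t * S \<omega>)) + ennreal (exp (-1 * t * S \<omega>))) \<partial>M)"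
  proof (rule nn_integral_mono)
    fix \<omega>
    have "1 \<le> exp (- (t * T)) * (exp (t * S \<omega>) + exp (- (t * S \<omega>)))" if "T < \<bar>S \<omega>\<bar>"
    proof -
      have "1 \<le> exp (t * (\<bar>S \<omega>\<bar> - T))" using that t by simp
      also have "\<dots> = exp (- (t * T)) * exp (t * \<bar>S \<omega>\<bar>)" by (simp add: algebra_simps mult_exp_exp)
      also have "exp (t * \<bar>S \<omega>\<bar>) \<le> exp (t * S \<omega>) + exp (- (t * S \<omega>))"
        by (cases "0 \<le> S \<omega>") (auto simp: abs_if)
      finally show ?thesis by simp
    qed
    then show "indicator {\<omega> \<in> space M. T < \<bar>S \<omega>\<bar>} \<omega>
        \<le> ennreal (exp (- (t * T))) * (ennreal (exp (1 * t * S \<omega>)) + ennreal (exp (-1 * t * S \<omega>)))"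
      by (auto simp: indicator_def simp flip: ennreal_plus ennreal_mult)
  qed
  also have "\<dots> = ennreal (exp (- (t * T)))
      * ((\<integral>\<^sup>+\<omega>. exp (1 * t * S \<omega>) \<partial>M) + (\<integral>\<^sup>+\<omega>. exp (-1 * t * S \<omega>) \<partial>M))"
    by (simp add: nn_integral_cmult nn_integral_add)
  also have "\<dots> \<le> ennreal (exp (- (t * T)))
      * (ennreal (exp (3 / 8 * X + 1 / 2)) + ennreal (exp (3 / 8 * X + 1 / 2)))"
    by (intro mult_left_mono add_mono mgf) auto
  also have "\<dots> = ennreal (2 * exp (1 / 2) * exp (- X / 8))"
  proof -
    have "exp (- (t * T)) * exp (3 / 8 * X + 1 / 2) = exp (1 / 2) * exp (- X / 8)"
      unfolding exponent mult_exp_exp by (rule arg_cong[where f = exp]) simp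
    then show ?thesis by (simp flip: ennreal_plus ennreal_mult)
  qed
  finally have tail: "prob {\<omega> \<in> space M. T < \<bar>S \<omega>\<bar>} \<le> 2 * exp (1 / 2) * exp (- X / 8)"
    by (simp add: emeasure_eq_measure)
  have "exp (1 / 2 :: real) \<le> exp 1" by simp
  also have "\<dots> \<le> 3" by (rule exp_le)
  finally have "2 * exp (1 / 2 :: real) \<le> 8" by simp
  moreover have "exp (- X / 8) \<le> exp (- (1/2) * \<gamma> * X)"
  proof -
    have "\<gamma> * X \<le> 1 / 4 * X" using \<gamma> by (intro mult_right_mono) (auto simp: X_def)
    then show ?thesis by (simp add: mult_ac)
  qed
  ultimately have "2 * exp (1 / 2) * exp (- X / 8) \<le> 8 * exp (- (1/2) * \<gamma> * X)"
    by (intro mult_mono) auto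
  with tail have "prob {\<omega> \<in> space M. T < \<bar>S \<omega>\<bar>} \<le> 8 * exp (- (1/2) * \<gamma> * X)" by linarith
  then show ?thesis
    by (simp add: S_def T_def X_def \<mu>_def \<nu>_def \<kappa>_def \<sigma>_def \<theta>_def B_def mult.assoc)
qed

lemma (in levy_ciesielski) measurable_level_field:
  assumes "(i, h, l) \<in> coeff_index d" "h \<le> n"
  shows "W i h l \<in> borel_measurable (level_field M d W n)"
proof (rule measurableI)
  fix B :: "real set" assume "B \<in> sets borel"
  then have "W i h l -` B \<inter> space M \<in> {W i m k -` B \<inter> space M | i m k B.
      (i, m, k) \<in> coeff_index d \<and> m \<le> n \<and> B \<in> sets borel}"
    using assms by blast
  then show "W i h l -` B \<inter> space (level_field M d W n) \<in> sets (level_field M d W n)"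
    unfolding level_field_def by (subst space_measure_of, blast, intro in_measure_of) auto
qed simp

lemma (in levy_ciesielski) subalgebra_level_field: "subalgebra M (level_field M d W n)"
proof -
  have "{W i m k -` B \<inter> space M | i m k B. (i, m, k) \<in> coeff_index d \<and> m \<le> n \<and> B \<in> sets borel} \<subseteq> sets M"
    using measurable_W by (auto intro: measurable_sets)
  then have "sets (level_field M d W n) \<subseteq> sets M"
    unfolding level_field_def by (subst sets_measure_of) (blast, rule sets.sigma_sets_subset)
  moreover have "space (level_field M d W n) = space M"
    unfolding level_field_def by (rule space_measure_of) blast
  ultimately show ?thesis by (simp add: subalgebra_def)
qed

text \<open>
  Every event of the conditioning field is an event in terms of the finite vector of coefficients of
  level at most \<open>n\<close>; this is the vector to be frozen.
\<close>

lemma (in levy_ciesielski) sets_level_field_subset_vimage: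
  assumes J: "J = {e \<in> coeff_index d. fst (snd e) \<le> n}"
  shows "sets (level_field M d W n)
    \<subseteq> sets (vimage_algebra (space M) (\<lambda>\<omega>. \<lambda>e\<in>J. coeff_at W e \<omega>) (PiM J (\<lambda>_. borel)))"
    (is "_ \<subseteq> sets ?V")
proof -
  have "W i h l -` B \<inter> space M \<in> sets ?V"
    if "(i, h, l) \<in> coeff_index d" "h \<le> n" "B \<in> sets borel" for i h l B
  proof -
    have e: "(i, h, l) \<in> J" using that by (simp add: J)
    have "(\<lambda>u. u (i, h, l)) -` B \<inter> space (PiM J (\<lambda>_. borel)) \<in> sets (PiM J (\<lambda>_. borel))"
      by (rule measurable_sets[OF measurable_component_singleton[OF e] that(3)])
    from in_vimage_algebra[OF this, of "\<lambda>\<omega>. \<lambda>e\<in>J. coeff_at W e \<omega>" "space M"]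
    have "(\<lambda>\<omega>. \<lambda>e\<in>J. coeff_at W e \<omega>) -` ((\<lambda>u. u (i, h, l)) -` B \<inter> space (PiM J (\<lambda>_. borel))) \<inter> space M
      \<in> sets ?V" .
    also have "(\<lambda>\<omega>. \<lambda>e\<in>J. coeff_at W e \<omega>) -` ((\<lambda>u. u (i, h, l)) -` B \<inter> space (PiM J (\<lambda>_. borel))) \<inter> space M
      = W i h l -` B \<inter> space M"
      using e by (auto simp: space_PiM)
    finally show ?thesis .
  qed
  then have "{W i m k -` B \<inter> space M | i m k B. (i, m, k) \<in> coeff_index d \<and> m \<le> n \<and> B \<in> sets borel} \<subseteq> sets ?V"
    by blast
  then have "sigma_sets (space ?V) {W i m k -` B \<inter> space M | i m k B.
      (i, m, k) \<in> coeff_index d \<and> m \<le> n \<and> B \<in> sets borel} \<subseteq> sets ?V"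
    by (rule sets.sigma_sets_subset)
  then show ?thesis
    unfolding level_field_def by (subst sets_measure_of) auto
qed

theorem proposition5p1:
  fixes M :: "'a measure"
    and W :: "nat \<Rightarrow> nat \<Rightarrow> nat \<Rightarrow> 'a \<Rightarrow> real"
    and d i j n m k k' :: nat
    and \<alpha> \<beta> \<alpha>' \<epsilon>\<^sub>0 \<gamma> :: real
  assumes "levy_ciesielski M d W"
    and "\<alpha> \<in> {1/3<..<1/2}" and "\<beta> \<in> {1 - \<alpha><..<2 * \<alpha>}"
    and "i \<in> {1..d}" and "j \<in> {1..d}" and "i \<noteq> j"
    and "1 \<le> m" and "k < k'" and "k' \<le> 2 ^ (n + m - 1)"
    and "\<alpha>' \<in> {\<alpha><..<1/2}" and "\<epsilon>\<^sub>0 \<in> {0<..<1/2}" and "0 < \<gamma>" and "\<gamma> \<le> 1/4"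
  shows "AE \<omega> in M.
    (\<forall>r\<in>{1..2 ^ n}. \<bar>incr W n i r \<omega>\<bar> \<le> \<Delta> n powr \<alpha>' \<and> \<bar>incr W n j r \<omega>\<bar> \<le> \<Delta> n powr \<alpha>') \<and>
    (\<forall>l q. l < q \<and> q \<le> 2 ^ n \<longrightarrow>
      \<bar>\<Sum>r = l + 1..q. incr W n i r \<omega> * incr W n j r \<omega>\<bar>
        \<le> \<epsilon>\<^sub>0 * real (q - l) powr \<beta> * \<Delta> n powr (2 * \<alpha>')) \<longrightarrow>
    cond_prob_given M (level_field M d W n)
      {x \<in> space M. \<bar>area_sum W (n + m) i j k' x - area_sum W (n + m) i j k x\<bar>
        > real (k' - k) powr \<beta> * \<Delta> (n + m) powr (2 * \<alpha>)} \<omega>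
    \<le> 8 * exp (- (1/2) * \<gamma> * real (k' - k) powr (\<beta> - 1/2)
        * \<Delta> n powr (2 * (\<alpha> - \<alpha>')) * \<Delta> m powr (2 * \<alpha> - 1))"
proof -
  interpret levy_ciesielski M d W by fact
  let ?C = "8 * exp (- (1/2) * \<gamma> * real (k' - k) powr (\<beta> - 1/2)
        * \<Delta> n powr (2 * (\<alpha> - \<alpha>')) * \<Delta> m powr (2 * \<alpha> - 1))"
  define T where "T = real (k' - k) powr \<beta> * \<Delta> (n + m) powr (2 * \<alpha>)"
  define good where "good x y \<longleftrightarrow>
    (\<forall>r\<in>{1..2 ^ n}. \<bar>x r\<bar> \<le> \<Delta> n powr \<alpha>' \<and> \<bar>y r\<bar> \<le> \<Delta> n powr \<alpha>') \<and>
    (\<forall>l q. l < q \<and> q \<le> 2 ^ n \<longrightarrow>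
      \<bar>\<Sum>r = l + 1..q. x r * y r\<bar> \<le> \<epsilon>\<^sub>0 * real (q - l) powr \<beta> * \<Delta> n powr (2 * \<alpha>'))"
    for x y :: "nat \<Rightarrow> real"
  \<comment> \<open>The coordinate process on families of coefficients: \<open>incr coord\<close> expresses increments as
    functions of the frozen coefficients.\<close>
  define coord :: "nat \<Rightarrow> nat \<Rightarrow> nat \<Rightarrow> (nat \<times> nat \<times> nat \<Rightarrow> real) \<Rightarrow> real"
    where "coord i h l u = u (i, h, l)" for i h l u
  \<comment> \<open>\<open>U\<close> collects the coefficients that generate the conditioning field, \<open>V\<close> those of the bridges.\<close>
  define J where "J = {e \<in> coeff_index d. fst (snd e) \<le> n}"
  define K where "K = {i, j} \<times> fine_index n m"
  define U where "U \<omega> = (\<lambda>e\<in>J. coeff_at W e \<omega>)" for \<omega>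
  define V where "V \<omega> = (\<lambda>e\<in>K. coeff_at W e \<omega>)" for \<omega>
  define N1 :: "(nat \<times> nat \<times> nat \<Rightarrow> real) measure" where "N1 = PiM J (\<lambda>_. borel)"
  define N2 :: "(nat \<times> nat \<times> nat \<Rightarrow> real) measure" where "N2 = PiM K (\<lambda>_. borel)"
  define L where "L u v = (\<Sum>r\<in>{k..<k'}.
      (incr coord n i (Suc (r div 2 ^ (m - 1))) u / 2 ^ m + bridge n m (\<lambda>e. v (i, e)) (2 * r))
      * (incr coord n j (Suc (r div 2 ^ (m - 1))) u / 2 ^ m + bridge n m (\<lambda>e. v (j, e)) (Suc (2 * r))))"
    for u v
  define G where "G = {u \<in> space N1. good (\<lambda>r. incr coord n i r u) (\<lambda>r. incr coord n j r u)}"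
  define Q where "Q = {p \<in> space (N1 \<Otimes>\<^sub>M N2). T < \<bar>L (fst p) (snd p)\<bar>}"

  have coarse: "(i', 0, 0) \<in> J" "h < n \<Longrightarrow> l \<in> {1..2 ^ h} \<Longrightarrow> (i', Suc h, l) \<in> J"
    if "i' \<in> {i, j}" for i' h l
    using that assms(4,5) by (auto simp: J_def coeff_index_def)
  have incr_U: "incr coord n i' r (U \<omega>) = incr W n i' r \<omega>" if "i' \<in> {i, j}" for i' r \<omega>
    by (rule incr_cong) (use coarse[OF that] in \<open>auto simp: coord_def U_def\<close>)
  have incr_meas: "incr coord n i' r \<in> borel_measurable N1" if "i' \<in> {i, j}" for i' r
    unfolding N1_def
    by (intro measurable_incr; unfold coord_def; intro measurable_component_singleton coarse[OF that]) auto
  have idx: "2 * r < 2 ^ (n + m)" "Suc (2 * r) < 2 ^ (n + m)" if "r \<in> {k..<k'}" for r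
  proof -
    have "(2::nat) ^ (n + m) = 2 * 2 ^ (n + m - 1)" using assms(7) by (simp flip: power_Suc)
    then show "2 * r < 2 ^ (n + m)" "Suc (2 * r) < 2 ^ (n + m)" using that assms(9) by auto
  qed
  have bridge_V: "bridge n m (\<lambda>e. V \<omega> (i', e)) s = bridge n m (\<lambda>(h, l). W i' h l \<omega>) s"
    if "i' \<in> {i, j}" "s < 2 ^ (n + m)" for i' s \<omega>
    using that by (intro bridge_cong) (auto simp: V_def K_def)
  have bridge_meas: "(\<lambda>v. bridge n m (\<lambda>e. v (i', e)) s) \<in> borel_measurable N2"
    if "i' \<in> {i, j}" "s < 2 ^ (n + m)" for i' s
    unfolding N2_def using that by (intro measurable_bridge measurable_component_singleton) (auto simp: K_def)
  have V_L: "L u (V \<omega>) = (\<Sum>r\<in>{k..<k'}.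
      (incr coord n i (Suc (r div 2 ^ (m - 1))) u / 2 ^ m + bridge n m (\<lambda>(h, l). W i h l \<omega>) (2 * r))
      * (incr coord n j (Suc (r div 2 ^ (m - 1))) u / 2 ^ m + bridge n m (\<lambda>(h, l). W j h l \<omega>) (Suc (2 * r))))" for u \<omega>
    unfolding L_def by (intro sum.cong refl) (simp add: bridge_V idx)
  have L_UV: "L (U \<omega>) (V \<omega>) = area_sum W (n + m) i j k' \<omega> - area_sum W (n + m) i j k \<omega>" for \<omega>
    unfolding V_L area_sum_diff[OF assms(7,8,9)] by (simp add: incr_U)
  have L_meas: "(\<lambda>p. L (fst p) (snd p)) \<in> borel_measurable (N1 \<Otimes>\<^sub>M N2)"
    unfolding L_def
    by (intro borel_measurable_sum borel_measurable_times borel_measurable_add borel_measurable_divide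
        measurable_compose[OF measurable_fst incr_meas] measurable_compose[OF measurable_snd bridge_meas]
        borel_measurable_const) (auto simp: idx)
  have indep: "indep_var N1 U N2 V"
    unfolding U_def V_def N1_def N2_def
  proof (rule indep_var_restrict[OF indep_coeffs])
    show "J \<inter> K = {}" by (auto simp: J_def K_def fine_index_def)
    show "K \<subseteq> coeff_index d" using assms(4,5) by (auto simp: K_def fine_index_def coeff_index_def)
  qed (auto simp: J_def)
  have U_space: "U \<omega> \<in> space N1" for \<omega> by (simp add: U_def N1_def space_PiM)
  have V_space: "V \<omega> \<in> space N2" for \<omega> by (simp add: V_def N2_def space_PiM)

  have "AE \<omega> in M. U \<omega> \<in> G \<longrightarrow>
    cond_prob_given M (level_field M d W n) {\<omega> \<in> space M. (U \<omega>, V \<omega>) \<in> Q} \<omega> \<le> ?C"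
  proof (rule cond_prob_given_le_freezing[OF prob_space_axioms subalgebra_level_field indep])
    show "U \<in> measurable (level_field M d W n) N1"
      unfolding U_def N1_def
    proof (rule measurable_restrict)
      fix e assume "e \<in> J"
      then show "coeff_at W e \<in> borel_measurable (level_field M d W n)"
        using measurable_level_field[of "fst e" "fst (snd e)" "snd (snd e)" n]
        by (simp add: J_def case_prod_unfold)
    qed
    show "sets (level_field M d W n) \<subseteq> sets (vimage_algebra (space M) U N1)"
      using sets_level_field_subset_vimage[OF J_def] by (simp add: U_def[abs_def] N1_def)
    show "Q \<in> sets (N1 \<Otimes>\<^sub>M N2)"
      unfolding Q_def using L_meas by measurable
    show "G \<in> sets N1"
    proof -
      note [measurable] = incr_meas[of i, simplified] incr_meas[of j, simplified]
      have "G = {u \<in> space N1.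
        (\<forall>r\<in>{1..2 ^ n}. \<bar>incr coord n i r u\<bar> \<le> \<Delta> n powr \<alpha>' \<and> \<bar>incr coord n j r u\<bar> \<le> \<Delta> n powr \<alpha>') \<and>
        (\<forall>q\<in>{..2 ^ n}. \<forall>l\<in>{..<q}. \<bar>\<Sum>r = l + 1..q. incr coord n i r u * incr coord n j r u\<bar>
          \<le> \<epsilon>\<^sub>0 * real (q - l) powr \<beta> * \<Delta> n powr (2 * \<alpha>'))}"
        unfolding G_def good_def by (intro Collect_cong) auto
      also have "\<dots> \<in> sets N1" by measurable
      finally show ?thesis .
    qed
    fix u assume "u \<in> G"
    then have good: "good (\<lambda>r. incr coord n i r u) (\<lambda>r. incr coord n j r u)" and u: "u \<in> space N1"
      by (auto simp: G_def)
    have "{\<omega> \<in> space M. (u, V \<omega>) \<in> Q} = {\<omega> \<in> space M. T < \<bar>L u (V \<omega>)\<bar>}"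
      using u V_space by (auto simp: Q_def space_pair_measure)
    also have "prob \<dots> \<le> ?C"
      unfolding V_L T_def
    proof (rule frozen_area_tail)
      show "\<bar>\<Sum>p\<in>{l..<q}. incr coord n i (Suc p) u * incr coord n j (Suc p) u\<bar>
          \<le> \<epsilon>\<^sub>0 * real (q - l) powr \<beta> * \<Delta> n powr (2 * \<alpha>')" if "l < q" "q \<le> 2 ^ n" for l q
      proof -
        have "(\<Sum>p\<in>{l..<q}. incr coord n i (Suc p) u * incr coord n j (Suc p) u)
          = (\<Sum>r = l + 1..q. incr coord n i r u * incr coord n j r u)"
          using sum.atLeast_Suc_lessThan_Suc_shift[of "\<lambda>r. incr coord n i r u * incr coord n j r u" l q]
          by (simp add: comp_def atLeastLessThanSuc_atLeastAtMost)
        then show ?thesis using good that by (simp add: good_def)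
      qed
      show "\<bar>incr coord n i (Suc p) u\<bar> \<le> \<Delta> n powr \<alpha>'" "\<bar>incr coord n j (Suc p) u\<bar> \<le> \<Delta> n powr \<alpha>'"
        if "p < 2 ^ n" for p
      proof -
        have "Suc p \<in> {1..2 ^ n}" using that by auto
        then show "\<bar>incr coord n i (Suc p) u\<bar> \<le> \<Delta> n powr \<alpha>'" "\<bar>incr coord n j (Suc p) u\<bar> \<le> \<Delta> n powr \<alpha>'"
          using good unfolding good_def by blast+
      qed
    qed (use assms in auto)
    finally show "prob {\<omega> \<in> space M. (u, V \<omega>) \<in> Q} \<le> ?C" .
  qed simp
  moreover have "{\<omega> \<in> space M. (U \<omega>, V \<omega>) \<in> Q} = {x \<in> space M.
      \<bar>area_sum W (n + m) i j k' x - area_sum W (n + m) i j k x\<bar>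
        > real (k' - k) powr \<beta> * \<Delta> (n + m) powr (2 * \<alpha>)}"
    using U_space V_space by (auto simp: Q_def space_pair_measure L_UV T_def)
  moreover have "U \<omega> \<in> G \<longleftrightarrow> good (\<lambda>r. incr W n i r \<omega>) (\<lambda>r. incr W n j r \<omega>)" for \<omega>
    using U_space by (simp add: G_def incr_U)
  ultimately show ?thesis unfolding good_def by simp
qed

end
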